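(* Let $G$ be a $\mathbf{W}$-object, let $F \subseteq G$ be a subset and let $f_0 \in G$. Then $f_0$ is the pointwise supremum of $F$ (in the sense of the Madden representation) if and only if, for every $\mathbf{W}$-morphism $\theta : G \to H$ out of $G$, $\theta(f_0) = \bigvee_{f \in F} \theta(f)$ in $H$. Dually, $f_0$ is the pointwise infimum of $F$ if and only if, for every $\mathbf{W}$-morphism $\theta : G \to H$ out of $G$, $\theta(f_0) = \bigwedge_{f \in F} \theta(f)$ in $H$.
   Context: $\mathbf{W}$ is the category of archimedean lattice-ordered groups $G$ with a designated weak order unit, written $1$ (so $1\ge 0$ and $g \wedge 1 = 0$ with $g \geq 0$ implies $g = 0$); morphisms are lattice-ordered group homomorphisms carrying designated unit to designated unit. A $\mathbf{W}$-kernel of $G$ is the kernel of a $\mathbf{W}$-morphism out of $G$. For $S \subseteq G$, $[S]$ is the smallest $\mathbf{W}$-kernel of $G$ containing $S$ (intersections of $\mathbf{W}$-kernels are $\mathbf{W}$-kernels). The $\mathbf{W}$-kernels of $G$, ordered by inclusion, form a (regular Lindelöf) frame $L = \mathcal{M}G$, the Madden frame of $G$. All frames are completely regular. $\mathcal{O}\mathbb{R}$ is the frame of open subsets of $\mathbb{R}$, and $\mathcal{R}L$ is the set of frame maps $\mathcal{O}\mathbb{R} \to L$; write $f(r,\infty)$ for $f((r,\infty))$, and similarly for $f(-\infty,r)$. $\mathcal{R}L$ is a $\mathbf{W}$-object: a continuous operation $w : \mathbb{R}^n \to \mathbb{R}$ lifts to $\mathcal{R}L$ by $w'(f_1,\dots,f_n)(U)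 = \bigvee \{ f_1(U_1)\wedge\dots\wedge f_n(U_n) : U_i \in \mathcal{O}\mathbb{R},\ w(U_1\times\dots\times U_n)\subseteq U\}$, a real constant $r$ is the map with $r(U) = \top$ if $r \in U$ and $\bot$ otherwise, the designated unit is the constant $1$, and $f \le g$ iff $f(r,\infty)\le g(r,\infty)$ for all $r \in \mathbb{R}$. The Madden representation $G \to \mathcal{R}L$, $g \mapsto \widehat g$, is the injective $\mathbf{W}$-morphism with $\widehat g(r,\infty) = [(g-r)^+]$. If the constant $r$ is not in $G$ this is read as follows: for rational $r=p/q$, $q>0$, $[(g-r)^+]$ means $[(qg - p\cdot 1)^+]$, and for arbitrary real $r$ it is the join of these over rationals $s>r$. $f_0\in G$ is the pointwise supremum of $F\subseteq G$ if $\widehat{f_0}(r,\infty) = \bigvee_{f\in F}\widehat f(r,\infty)$ in $L$ for all $r\in\mathbb{R}$; it is the pointwise infimum of $F$ if $\widehat{f_0}(-\infty,r) = \bigvee_{f\in F}\widehat f(-\infty,r)$ in $L$ for all $r\in\mathbb{R}$. *)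

theory Defs
  imports Complex_Main "HOL-Algebra.Algebra"
begin

text \<open>
  Lattice-ordered groups are carrier-based, and the group operation is written multiplicatively,
  as always in \<open>HOL-Algebra\<close>: \<open>\<one>\<close> is the neutral element (the zero of additive
  notation), \<open>g [^] n\<close> is the multiple \<open>n g\<close>, and the designated weak order unit is the record
  field \<open>wunit\<close>.
\<close>

record 'a wgroup = "'a monoid" +
  wle :: "'a \<Rightarrow> 'a \<Rightarrow> bool"
  wunit :: 'a

definition ord_of :: "'a wgroup \<Rightarrow> 'a gorder" where
  "ord_of G = \<lparr>carrier = carrier G, eq = (=), le = wle G\<rparr>"

locale W_object = comm_group G for G :: "'a wgroup" (structure) +
  assumes lattice_ord: "lattice (ord_of G)"
    and translate: "\<lbrakk>x \<in> carrier G; y \<in> carrier G; z \<in> carrier G; wle G x y\<rbrakk>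
      \<Longrightarrow> wle G (x \<otimes> z) (y \<otimes> z)"
    and archimedean: "\<lbrakk>x \<in> carrier G; y \<in> carrier G; wle G \<one> x; \<forall>n::nat. wle G (x [^] n) y\<rbrakk>
      \<Longrightarrow> x = \<one>"
    and wunit_closed: "wunit G \<in> carrier G"
    and wunit_nonneg: "wle G \<one> (wunit G)"
    and wunit_weak: "\<lbrakk>x \<in> carrier G; wle G \<one> x; x \<sqinter>\<^bsub>ord_of G\<^esub> wunit G = \<one>\<rbrakk> \<Longrightarrow> x = \<one>"

locale W_morphism = dom: W_object G + cod: W_object H
  for G :: "'a wgroup" and H :: "'b wgroup" and \<theta> :: "'a \<Rightarrow> 'b" +
  assumes hom: "\<theta> \<in> hom G H"
    and join: "\<lbrakk>x \<in> carrier G; y \<in> carrier G\<rbrakk>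
      \<Longrightarrow> \<theta> (x \<squnion>\<^bsub>ord_of G\<^esub> y) = \<theta> x \<squnion>\<^bsub>ord_of H\<^esub> \<theta> y"
    and meet: "\<lbrakk>x \<in> carrier G; y \<in> carrier G\<rbrakk>
      \<Longrightarrow> \<theta> (x \<sqinter>\<^bsub>ord_of G\<^esub> y) = \<theta> x \<sqinter>\<^bsub>ord_of H\<^esub> \<theta> y"
    and unit: "\<theta> (wunit G) = wunit H"

text \<open>
  A formula cannot quantify over the type carrying the codomain. Codomains on the type of \<open>G\<close>
  itself already yield all kernels; this is lemma \<open>W_kernelI\<close> below.
\<close>

definition W_kernel :: "'a wgroup \<Rightarrow> 'a set \<Rightarrow> bool" where
  "W_kernel G K \<longleftrightarrow> (\<exists>(H :: 'a wgroup) \<theta>. W_morphism G H \<theta> \<and> K = kernel G H \<theta>)"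

definition W_kernel_gen :: "'a wgroup \<Rightarrow> 'a set \<Rightarrow> 'a set" where
  "W_kernel_gen G S = \<Inter>{K. W_kernel G K \<and> S \<subseteq> K}"

definition madden_frame :: "'a wgroup \<Rightarrow> 'a set gorder" where
  "madden_frame G = \<lparr>carrier = {K. W_kernel G K}, eq = (=), le = (\<subseteq>)\<rparr>"

text \<open>
  The set of frame maps from the opens of the real line to \<open>L\<close>. They are extensional, so that a
  frame map is determined by its values on open sets.
\<close>

definition real_frame_maps :: "'b gorder \<Rightarrow> (real set \<Rightarrow> 'b) set" where
  "real_frame_maps L = {\<phi> \<in> {U. open U} \<rightarrow>\<^sub>E carrier L.
     \<phi> UNIV = \<top>\<^bsub>L\<^esub> \<and>
     (\<forall>U V. open U \<longrightarrow> open V \<longrightarrow> \<phi> (U \<inter> V) = \<phi> U \<sqinter>\<^bsub>L\<^esub> \<phi> V) \<and>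
     (\<forall>\<U>. (\<forall>U\<in>\<U>. open U) \<longrightarrow> \<phi> (\<Union>\<U>) = \<Squnion>\<^bsub>L\<^esub> (\<phi> ` \<U>))}"

text \<open>The \<open>W\<close>-kernel generated by \<open>(q g - p 1)\<^sup>+\<close>, additively written.\<close>

definition ray_kernel :: "'a wgroup \<Rightarrow> 'a \<Rightarrow> int \<Rightarrow> int \<Rightarrow> 'a set" where
  "ray_kernel G g p q =
     W_kernel_gen G {(g [^]\<^bsub>G\<^esub> q \<otimes>\<^bsub>G\<^esub> inv\<^bsub>G\<^esub> (wunit G [^]\<^bsub>G\<^esub> p)) \<squnion>\<^bsub>ord_of G\<^esub> \<one>\<^bsub>G\<^esub>}"

text \<open>
  The Madden representation of \<open>g\<close>: a frame map on the opens of the real line is determined by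
  its values on the upper rays. The two clauses prescribe them at rational and at arbitrary
  endpoints.
\<close>

definition madden_rep :: "'a wgroup \<Rightarrow> 'a \<Rightarrow> real set \<Rightarrow> 'a set" where
  "madden_rep G g = (THE \<phi>. \<phi> \<in> real_frame_maps (madden_frame G) \<and>
     (\<forall>p q. 0 < q \<longrightarrow> \<phi> {of_int p / of_int q <..} = ray_kernel G g p q) \<and>
     (\<forall>r. \<phi> {r<..} =
        \<Squnion>\<^bsub>madden_frame G\<^esub> {ray_kernel G g p q | p q. 0 < q \<and> r < of_int p / of_int q}))"

definition pointwise_sup :: "'a wgroup \<Rightarrow> 'a set \<Rightarrow> 'a \<Rightarrow> bool" where
  "pointwise_sup G F f\<^sub>0 \<longleftrightarrow>
     (\<forall>r. madden_rep G f\<^sub>0 {r<..} = \<Squnion>\<^bsub>madden_frame G\<^esub> ((\<lambda>f. madden_rep G f {r<..}) ` F))"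

definition pointwise_inf :: "'a wgroup \<Rightarrow> 'a set \<Rightarrow> 'a \<Rightarrow> bool" where
  "pointwise_inf G F f\<^sub>0 \<longleftrightarrow>
     (\<forall>r. madden_rep G f\<^sub>0 {..<r} = \<Squnion>\<^bsub>madden_frame G\<^esub> ((\<lambda>f. madden_rep G f {..<r}) ` F))"

lemma ord_of_simps [simp]:
  "carrier (ord_of G) = carrier G" "eq (ord_of G) = (=)" "le (ord_of G) = wle G"
  by (simp_all add: ord_of_def)

lemma (in partial_order) join_eqI:
  assumes "is_lub L s {x, y}" shows "x \<squnion> y = s"
  using assms least_unique unfolding join_def sup_def by (metis someI)

lemma (in partial_order) meet_eqI:
  assumes "is_glb L s {x, y}" shows "x \<sqinter> y = s"
  using assms greatest_unique unfolding meet_def inf_def by (metis someI)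

text \<open>
  To replace the codomain \<open>H\<close> by one on the type of \<open>G\<close>, transport the image of \<open>\<theta>\<close> along a
  choice of preimages.
\<close>

lemma W_kernelI:
  fixes G :: "'a wgroup" and H :: "'b wgroup"
  assumes "W_morphism G H \<theta>"
  shows "W_kernel G (kernel G H \<theta>)"
proof -
  interpret W_morphism G H \<theta> by fact
  interpret LG: lattice "ord_of G" by (rule dom.lattice_ord)
  interpret LH: lattice "ord_of H" by (rule cod.lattice_ord)
  define s where "s = inv_into (carrier G) \<theta>"
  define e where "e x = s (\<theta> x)" for x
  define C where "C = e ` carrier G"
  have \<theta>_closed [simp]: "\<theta> x \<in> carrier H" if "x \<in> carrier G" for x
    using hom that by (auto simp: hom_def)
  have \<theta>_mult: "\<theta> (x \<otimes>\<^bsub>G\<^esub> y) = \<theta> x \<otimes>\<^bsub>H\<^esub> \<theta> y" if "x \<in> carrier G" "y \<in> carrier G" for x y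
    using hom that by (auto simp: hom_def)
  interpret group_hom G H \<theta>
    by unfold_locales (rule hom)
  have e_closed [simp]: "e x \<in> carrier G" and \<theta>_e [simp]: "\<theta> (e x) = \<theta> x"
    if "x \<in> carrier G" for x
    using that by (auto simp: e_def s_def inv_into_into f_inv_into_f)
  have e_eq_iff [simp]: "e x = e y \<longleftrightarrow> \<theta> x = \<theta> y" if "x \<in> carrier G" "y \<in> carrier G" for x y
    using that by (metis e_def \<theta>_e)
  have C_closed [simp]: "x \<in> carrier G" and e_id [simp]: "e x = x" if "x \<in> C" for x
    using that by (auto simp: C_def)
  have eC [simp]: "e x \<in> C" if "x \<in> carrier G" for x
    unfolding C_def using that by (rule imageI)
  have C_eq: "x = y" if "x \<in> C" "y \<in> C" "\<theta> x = \<theta> y" for x y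
    using that by (metis C_closed e_eq_iff e_id)
  define H' :: "'a wgroup" where "H' = \<lparr>carrier = C, monoid.mult = (\<lambda>x y. e (x \<otimes>\<^bsub>G\<^esub> y)),
    one = e \<one>\<^bsub>G\<^esub>, wle = (\<lambda>x y. wle H (\<theta> x) (\<theta> y)), wunit = e (wunit G)\<rparr>"
  have H'_simps [simp]: "carrier H' = C" "x \<otimes>\<^bsub>H'\<^esub> y = e (x \<otimes>\<^bsub>G\<^esub> y)" "\<one>\<^bsub>H'\<^esub> = e \<one>\<^bsub>G\<^esub>"
    "wle H' x y \<longleftrightarrow> wle H (\<theta> x) (\<theta> y)" "wunit H' = e (wunit G)" for x y
    by (simp_all add: H'_def)
  note [simp] = dom.wunit_closed
  have "comm_group H'"
  proof (rule comm_groupI)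
    fix x y z assume "x \<in> carrier H'" "y \<in> carrier H'" "z \<in> carrier H'"
    then show "x \<otimes>\<^bsub>H'\<^esub> y \<otimes>\<^bsub>H'\<^esub> z = x \<otimes>\<^bsub>H'\<^esub> (y \<otimes>\<^bsub>H'\<^esub> z)"
      by (simp add: cod.m_assoc)
  next
    fix x assume "x \<in> carrier H'"
    then have x: "x \<in> C" by simp
    then have "e (inv\<^bsub>G\<^esub> x) \<otimes>\<^bsub>H'\<^esub> x = \<one>\<^bsub>H'\<^esub>"
      by (simp del: hom_mult add: \<theta>_mult)
    with x show "\<exists>y\<in>carrier H'. y \<otimes>\<^bsub>H'\<^esub> x = \<one>\<^bsub>H'\<^esub>"
      by (intro bexI[of _ "e (inv\<^bsub>G\<^esub> x)"]) auto
  next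
    fix x y assume "x \<in> carrier H'" "y \<in> carrier H'"
    then show "x \<otimes>\<^bsub>H'\<^esub> y = y \<otimes>\<^bsub>H'\<^esub> x"
      by (simp add: cod.m_comm)
  next
    fix x assume "x \<in> carrier H'"
    then show "\<one>\<^bsub>H'\<^esub> \<otimes>\<^bsub>H'\<^esub> x = x"
      by (auto intro: C_eq)
  qed auto
  have po: "partial_order (ord_of H')"
  proof unfold_locales
    fix x y z assume "x \<sqsubseteq>\<^bsub>ord_of H'\<^esub> y" "y \<sqsubseteq>\<^bsub>ord_of H'\<^esub> z" "x \<in> carrier (ord_of H')"
      "y \<in> carrier (ord_of H')" "z \<in> carrier (ord_of H')"
    then show "x \<sqsubseteq>\<^bsub>ord_of H'\<^esub> z"
      using LH.le_trans[of "\<theta> x" "\<theta> y" "\<theta> z"] by simp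
  next
    fix x y assume "x \<sqsubseteq>\<^bsub>ord_of H'\<^esub> y" "y \<sqsubseteq>\<^bsub>ord_of H'\<^esub> x" "x \<in> carrier (ord_of H')"
      "y \<in> carrier (ord_of H')"
    then show "x .=\<^bsub>ord_of H'\<^esub> y"
      using LH.le_antisym[of "\<theta> x" "\<theta> y"] C_eq[of x y] by simp
  next
    fix x assume "x \<in> carrier (ord_of H')"
    then show "x \<sqsubseteq>\<^bsub>ord_of H'\<^esub> x" using LH.le_refl[of "\<theta> x"] by simp
  qed auto
  interpret P: partial_order "ord_of H'" by (rule po)
  have lub: "is_lub (ord_of H') (e (x \<squnion>\<^bsub>ord_of G\<^esub> y)) {x, y}" if "x \<in> C" "y \<in> C" for x y
  proof -
    have xy: "x \<in> carrier G" "y \<in> carrier G" using that by auto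
    have j: "x \<squnion>\<^bsub>ord_of G\<^esub> y \<in> carrier G" using LG.join_closed xy by simp
    show ?thesis
      using that j xy LH.join_left[of "\<theta> x" "\<theta> y"] LH.join_right[of "\<theta> x" "\<theta> y"]
      by (auto simp: least_def Upper_def join intro!: LH.join_le[simplified])
  qed
  have glb: "is_glb (ord_of H') (e (x \<sqinter>\<^bsub>ord_of G\<^esub> y)) {x, y}" if "x \<in> C" "y \<in> C" for x y
  proof -
    have xy: "x \<in> carrier G" "y \<in> carrier G" using that by auto
    have j: "x \<sqinter>\<^bsub>ord_of G\<^esub> y \<in> carrier G" using LG.meet_closed xy by simp
    show ?thesis
      using that j xy LH.meet_left[of "\<theta> x" "\<theta> y"] LH.meet_right[of "\<theta> x" "\<theta> y"]
      by (auto simp: greatest_def Lower_def meet intro!: LH.meet_le[simplified])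
  qed
  have lat: "lattice (ord_of H')"
    by unfold_locales (simp, blast intro: lub glb)+
  have join': "x \<squnion>\<^bsub>ord_of H'\<^esub> y = e (x \<squnion>\<^bsub>ord_of G\<^esub> y)" if "x \<in> C" "y \<in> C" for x y
    using lub[OF that] by (rule P.join_eqI)
  have meet': "x \<sqinter>\<^bsub>ord_of H'\<^esub> y = e (x \<sqinter>\<^bsub>ord_of G\<^esub> y)" if "x \<in> C" "y \<in> C" for x y
    using glb[OF that] by (rule P.meet_eqI)
  interpret H': comm_group H' by fact
  have pow: "\<theta> (x [^]\<^bsub>H'\<^esub> n) = \<theta> x [^]\<^bsub>H\<^esub> n" if "x \<in> C" for x and n :: nat
  proof (induction n)
    case (Suc n)
    have "x [^]\<^bsub>H'\<^esub> n \<in> C" using H'.nat_pow_closed[of x n] that by simp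
    with Suc that show ?case by simp
  qed simp
  have "W_object H'"
  proof (intro W_object.intro W_object_axioms.intro)
    fix x y z assume "x \<in> carrier H'" "y \<in> carrier H'" "z \<in> carrier H'" "wle H' x y"
    then show "wle H' (x \<otimes>\<^bsub>H'\<^esub> z) (y \<otimes>\<^bsub>H'\<^esub> z)" by (simp add: cod.translate)
  next
    fix x y assume "x \<in> carrier H'" "y \<in> carrier H'" "wle H' \<one>\<^bsub>H'\<^esub> x"
      "\<forall>n::nat. wle H' (x [^]\<^bsub>H'\<^esub> n) y"
    then have "\<theta> x = \<one>\<^bsub>H\<^esub>" using cod.archimedean[of "\<theta> x" "\<theta> y"] pow by simp
    with \<open>x \<in> carrier H'\<close> show "x = \<one>\<^bsub>H'\<^esub>" by (auto intro: C_eq)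
  next
    fix x assume x: "x \<in> carrier H'" "wle H' \<one>\<^bsub>H'\<^esub> x" "x \<sqinter>\<^bsub>ord_of H'\<^esub> wunit H' = \<one>\<^bsub>H'\<^esub>"
    have "e (x \<sqinter>\<^bsub>ord_of G\<^esub> e (wunit G)) = e \<one>\<^bsub>G\<^esub>" using x meet' by simp
    then have "\<theta> x \<sqinter>\<^bsub>ord_of H\<^esub> wunit H = \<one>\<^bsub>H\<^esub>"
      using x LG.meet_closed[of x "e (wunit G)"] by (simp add: meet unit)
    then have "\<theta> x = \<one>\<^bsub>H\<^esub>" using cod.wunit_weak[of "\<theta> x"] x by simp
    with x(1) show "x = \<one>\<^bsub>H'\<^esub>" by (auto intro: C_eq)
  qed (use lat cod.wunit_nonneg unit \<open>comm_group H'\<close> in auto)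
  moreover have "e \<in> hom G H'" by (auto simp: hom_def)
  moreover have "e (x \<squnion>\<^bsub>ord_of G\<^esub> y) = e x \<squnion>\<^bsub>ord_of H'\<^esub> e y"
    "e (x \<sqinter>\<^bsub>ord_of G\<^esub> y) = e x \<sqinter>\<^bsub>ord_of H'\<^esub> e y" if "x \<in> carrier G" "y \<in> carrier G" for x y
    using that LG.join_closed LG.meet_closed by (simp_all add: join' meet' join meet)
  ultimately have "W_morphism G H' e"
    by (intro W_morphism.intro W_morphism_axioms.intro dom.W_object_axioms) auto
  moreover have "kernel G H \<theta> = kernel G H' e" by (auto simp: kernel_def)
  ultimately show ?thesis unfolding W_kernel_def by blast
qed

end

theory Submission
  imports Defs
begin

text \<open>
  A subset is a \<open>W\<close>-kernel iff it is a convex lattice subgroup modulo which the group is archimedean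
  and the unit is weak. Such ideals are closed under intersections and residuals, which yields the
  frame structure. The Madden representation of \<open>g\<close> sends an open \<open>U\<close> to the kernel generated by
  the elements \<open>(q g - p)\<^sup>+ \<and> (r - q g)\<^sup>+\<close> with \<open>(p/q, r/q) \<subseteq> U\<close>; that this preserves unions is
  a compactness argument in which overlapping intervals are glued by weakness of the unit and the
  ends are restored by archimedeanness.

  Hence \<open>f\<^sub>0\<close> is the pointwise supremum of \<open>F\<close> iff a \<open>W\<close>-kernel contains \<open>(q f\<^sub>0 - p)\<^sup>+\<close> exactly
  when it contains all \<open>(q f - p)\<^sup>+\<close> with \<open>f \<in> F\<close>. Given an upper bound \<open>b\<close> of \<open>\<theta>(F)\<close>, apply this to the
  preimage under \<open>\<theta>\<close> of the kernel generated by \<open>(q b - p)\<^sup>+\<close>: that kernel contains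
  \<open>(q \<theta>(f\<^sub>0) - p)\<^sup>+\<close> for all \<open>p, q\<close>, which forces \<open>\<theta>(f\<^sub>0) \<le> b\<close>. Conversely, if \<open>\<theta>\<close> has kernel \<open>K\<close>, then
  \<open>(q f - p)\<^sup>+ \<in> K\<close> means \<open>q \<theta>(f) \<le> p\<close>, and multiplication by \<open>q\<close> preserves existing suprema.
  Infima reduce to suprema through \<open>g \<mapsto> -g\<close>, which reflects the representation in \<open>0\<close>.
\<close>

section \<open>Abelian lattice-ordered groups\<close>

context W_object
begin

sublocale ord: lattice "ord_of G"
  by (rule lattice_ord)

abbreviation ljoin (infixl "\<^bold>\<squnion>" 65) where "x \<^bold>\<squnion> y \<equiv> x \<squnion>\<^bsub>ord_of G\<^esub> y"
abbreviation lmeet (infixl "\<^bold>\<sqinter>" 70) where "x \<^bold>\<sqinter> y \<equiv> x \<sqinter>\<^bsub>ord_of G\<^esub> y"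
abbreviation unit_elem ("\<u>") where "\<u> \<equiv> wunit G"

text \<open>Membership in the carrier is built into the relation, so that closure side conditions
  can be read off from order facts.\<close>

definition leq (infix "\<preceq>" 50) where
  "x \<preceq> y \<longleftrightarrow> x \<in> carrier G \<and> y \<in> carrier G \<and> wle G x y"

definition pos where "pos x = x \<^bold>\<squnion> \<one>"

lemma join_closed [simp, intro]: "x \<in> carrier G \<Longrightarrow> y \<in> carrier G \<Longrightarrow> x \<^bold>\<squnion> y \<in> carrier G"
  using ord.join_closed by simp

lemma meet_closed [simp, intro]: "x \<in> carrier G \<Longrightarrow> y \<in> carrier G \<Longrightarrow> x \<^bold>\<sqinter> y \<in> carrier G"
  using ord.meet_closed by simp

lemma unit_closed [simp, intro]: "\<u> \<in> carrier G"
  by (rule wunit_closed)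

lemma pos_closed [simp, intro]: "x \<in> carrier G \<Longrightarrow> pos x \<in> carrier G"
  by (simp add: pos_def)

lemma leq_closed: "x \<preceq> y \<Longrightarrow> x \<in> carrier G" "x \<preceq> y \<Longrightarrow> y \<in> carrier G"
  by (auto simp: leq_def)

lemma leq_refl [simp, intro]: "x \<in> carrier G \<Longrightarrow> x \<preceq> x"
  using ord.le_refl by (simp add: leq_def)

lemma leq_trans [trans]: "x \<preceq> y \<Longrightarrow> y \<preceq> z \<Longrightarrow> x \<preceq> z"
  using ord.le_trans by (auto simp: leq_def)

lemma leq_antisym: "x \<preceq> y \<Longrightarrow> y \<preceq> x \<Longrightarrow> x = y"
  using ord.le_antisym by (auto simp: leq_def)

lemma join_left [simp, intro]: "x \<in> carrier G \<Longrightarrow> y \<in> carrier G \<Longrightarrow> x \<preceq> x \<^bold>\<squnion> y"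
  and join_right [simp, intro]: "x \<in> carrier G \<Longrightarrow> y \<in> carrier G \<Longrightarrow> y \<preceq> x \<^bold>\<squnion> y"
  and meet_left [simp, intro]: "x \<in> carrier G \<Longrightarrow> y \<in> carrier G \<Longrightarrow> x \<^bold>\<sqinter> y \<preceq> x"
  and meet_right [simp, intro]: "x \<in> carrier G \<Longrightarrow> y \<in> carrier G \<Longrightarrow> x \<^bold>\<sqinter> y \<preceq> y"
  using ord.join_left ord.join_right ord.meet_left ord.meet_right by (auto simp: leq_def)

lemma join_least: "x \<preceq> z \<Longrightarrow> y \<preceq> z \<Longrightarrow> x \<^bold>\<squnion> y \<preceq> z"
  and meet_greatest: "z \<preceq> x \<Longrightarrow> z \<preceq> y \<Longrightarrow> z \<preceq> x \<^bold>\<sqinter> y"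
  using ord.join_le ord.meet_le by (auto simp: leq_def)

lemma join_eqI:
  assumes "x \<preceq> s" "y \<preceq> s" "\<And>z. x \<preceq> z \<Longrightarrow> y \<preceq> z \<Longrightarrow> s \<preceq> z"
  shows "x \<^bold>\<squnion> y = s"
  using assms by (meson leq_antisym join_left join_least join_right leq_closed)

lemma meet_eqI:
  assumes "s \<preceq> x" "s \<preceq> y" "\<And>z. z \<preceq> x \<Longrightarrow> z \<preceq> y \<Longrightarrow> z \<preceq> s"
  shows "x \<^bold>\<sqinter> y = s"
  using assms by (meson leq_antisym meet_left meet_greatest meet_right leq_closed)

lemma join_commute: "x \<in> carrier G \<Longrightarrow> y \<in> carrier G \<Longrightarrow> x \<^bold>\<squnion> y = y \<^bold>\<squnion> x"
  by (auto intro: join_eqI join_least)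

lemma meet_commute: "x \<in> carrier G \<Longrightarrow> y \<in> carrier G \<Longrightarrow> x \<^bold>\<sqinter> y = y \<^bold>\<sqinter> x"
  by (auto intro: meet_eqI meet_greatest)

lemma join_absorb: "x \<preceq> y \<Longrightarrow> x \<^bold>\<squnion> y = y"
  by (rule join_eqI) (auto dest: leq_closed)

lemma meet_absorb: "x \<preceq> y \<Longrightarrow> x \<^bold>\<sqinter> y = x"
  by (rule meet_eqI) (auto dest: leq_closed)

lemma meet_mono: "x \<preceq> x' \<Longrightarrow> y \<preceq> y' \<Longrightarrow> x \<^bold>\<sqinter> y \<preceq> x' \<^bold>\<sqinter> y'"
  by (meson leq_closed leq_trans meet_greatest meet_left meet_right)

lemma join_mono: "x \<preceq> x' \<Longrightarrow> y \<preceq> y' \<Longrightarrow> x \<^bold>\<squnion> y \<preceq> x' \<^bold>\<squnion> y'"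
  by (meson leq_closed leq_trans join_least join_left join_right)

lemma meet_assoc:
  "x \<in> carrier G \<Longrightarrow> y \<in> carrier G \<Longrightarrow> z \<in> carrier G \<Longrightarrow> (x \<^bold>\<sqinter> y) \<^bold>\<sqinter> z = x \<^bold>\<sqinter> (y \<^bold>\<sqinter> z)"
  using ord.meet_assoc by simp

lemma mult_right_mono: "x \<preceq> y \<Longrightarrow> z \<in> carrier G \<Longrightarrow> x \<otimes> z \<preceq> y \<otimes> z"
  using translate by (auto simp: leq_def)

lemma mult_mono:
  assumes "x \<preceq> y" "z \<preceq> w" shows "x \<otimes> z \<preceq> y \<otimes> w"
proof -
  note [simp] = assms[THEN leq_closed(1)] assms[THEN leq_closed(2)]
  have "x \<otimes> z \<preceq> y \<otimes> z" using assms by (simp add: mult_right_mono)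
  also have "y \<otimes> z \<preceq> y \<otimes> w" using assms mult_right_mono[of z w y] by (simp add: m_comm)
  finally show ?thesis .
qed

lemma leq_iff_diff: "x \<in> carrier G \<Longrightarrow> y \<in> carrier G \<Longrightarrow> x \<preceq> y \<longleftrightarrow> x \<otimes> inv y \<preceq> \<one>"
proof
  assume "x \<in> carrier G" "y \<in> carrier G" "x \<preceq> y"
  then show "x \<otimes> inv y \<preceq> \<one>" using mult_right_mono[of x y "inv y"] by simp
next
  assume "x \<in> carrier G" "y \<in> carrier G" "x \<otimes> inv y \<preceq> \<one>"
  then show "x \<preceq> y" using mult_right_mono[of "x \<otimes> inv y" \<one> y] by (simp add: m_assoc)
qed

lemma inv_antimono: "x \<preceq> y \<Longrightarrow> inv y \<preceq> inv x"
proof -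
  assume "x \<preceq> y"
  moreover from this have "x \<in> carrier G" "y \<in> carrier G" by (auto dest: leq_closed)
  moreover from this have "x \<otimes> (inv x \<otimes> inv y) = inv y" "y \<otimes> (inv x \<otimes> inv y) = inv x"
    by (simp flip: m_assoc, simp add: m_lcomm[of y])
  ultimately show ?thesis using mult_right_mono[of x y "inv x \<otimes> inv y"] by simp
qed

lemma inv_le_iff: "x \<in> carrier G \<Longrightarrow> y \<in> carrier G \<Longrightarrow> inv x \<preceq> y \<longleftrightarrow> inv y \<preceq> x"
  by (metis inv_antimono inv_inv)

lemma join_mult:
  assumes "x \<in> carrier G" "y \<in> carrier G" "z \<in> carrier G"
  shows "(x \<^bold>\<squnion> y) \<otimes> z = (x \<otimes> z) \<^bold>\<squnion> (y \<otimes> z)"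
proof (rule join_eqI[symmetric])
  fix w assume w: "x \<otimes> z \<preceq> w" "y \<otimes> z \<preceq> w"
  then have "w \<in> carrier G" by (auto dest: leq_closed)
  have "x \<preceq> w \<otimes> inv z" "y \<preceq> w \<otimes> inv z"
    using w[THEN mult_right_mono, of "inv z"] assms by (simp_all add: m_assoc)
  then have "x \<^bold>\<squnion> y \<preceq> w \<otimes> inv z" by (rule join_least)
  then show "(x \<^bold>\<squnion> y) \<otimes> z \<preceq> w"
    using mult_right_mono[of _ _ z] assms \<open>w \<in> carrier G\<close> by (fastforce simp: m_assoc)
qed (use assms in \<open>auto intro: mult_right_mono\<close>)

lemma meet_mult:
  assumes "x \<in> carrier G" "y \<in> carrier G" "z \<in> carrier G"
  shows "(x \<^bold>\<sqinter> y) \<otimes> z = (x \<otimes> z) \<^bold>\<sqinter> (y \<otimes> z)"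
proof (rule meet_eqI[symmetric])
  fix w assume w: "w \<preceq> x \<otimes> z" "w \<preceq> y \<otimes> z"
  then have "w \<in> carrier G" by (auto dest: leq_closed)
  have "w \<otimes> inv z \<preceq> x" "w \<otimes> inv z \<preceq> y"
    using w[THEN mult_right_mono, of "inv z"] assms by (simp_all add: m_assoc)
  then have "w \<otimes> inv z \<preceq> x \<^bold>\<sqinter> y" by (rule meet_greatest)
  then show "w \<preceq> (x \<^bold>\<sqinter> y) \<otimes> z"
    using mult_right_mono[of _ _ z] assms \<open>w \<in> carrier G\<close> by (fastforce simp: m_assoc)
qed (use assms in \<open>auto intro: mult_right_mono\<close>)

lemma inv_meet:
  assumes "x \<in> carrier G" "y \<in> carrier G"
  shows "inv (x \<^bold>\<sqinter> y) = inv x \<^bold>\<squnion> inv y"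
proof (rule join_eqI[symmetric])
  fix z assume z: "inv x \<preceq> z" "inv y \<preceq> z"
  then have "z \<in> carrier G" by (auto dest: leq_closed)
  with z assms have "inv z \<preceq> x \<^bold>\<sqinter> y" by (simp add: inv_le_iff meet_greatest)
  with \<open>z \<in> carrier G\<close> assms show "inv (x \<^bold>\<sqinter> y) \<preceq> z" by (simp add: inv_le_iff)
qed (use assms in \<open>auto intro: inv_antimono\<close>)

text \<open>Inversion turns the meet into a join, and translating that join by
  \<open>x \<otimes> y\<close> replaces \<open>inv x\<close> and \<open>inv y\<close> by
  \<open>y\<close> and \<open>x\<close>.\<close>

lemma join_meet_mult:
  assumes "x \<in> carrier G" "y \<in> carrier G"
  shows "(x \<^bold>\<squnion> y) \<otimes> (x \<^bold>\<sqinter> y) = x \<otimes> y"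
proof -
  have "(inv x \<^bold>\<squnion> inv y) \<otimes> (x \<otimes> y) = y \<^bold>\<squnion> x"
  proof -
    have "inv x \<otimes> (x \<otimes> y) = y" "inv y \<otimes> (x \<otimes> y) = x"
      using assms by (simp flip: m_assoc, simp add: m_lcomm[of "inv y"])
    then show ?thesis using assms by (simp add: join_mult)
  qed
  then have "inv (x \<^bold>\<sqinter> y) \<otimes> (x \<otimes> y) = x \<^bold>\<squnion> y"
    using assms by (simp add: inv_meet join_commute)
  then have "(x \<^bold>\<squnion> y) \<otimes> (x \<^bold>\<sqinter> y) = (x \<^bold>\<sqinter> y) \<otimes> (inv (x \<^bold>\<sqinter> y) \<otimes> (x \<otimes> y))"
    using assms by (simp add: m_comm)
  also have "\<dots> = x \<otimes> y" using assms by (simp flip: m_assoc)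
  finally show ?thesis .
qed

lemma one_le_mult: "\<one> \<preceq> x \<Longrightarrow> \<one> \<preceq> y \<Longrightarrow> \<one> \<preceq> x \<otimes> y"
  using mult_mono[of \<one> x \<one> y] by simp

lemma le_mult: "x \<in> carrier G \<Longrightarrow> \<one> \<preceq> y \<Longrightarrow> x \<preceq> x \<otimes> y" 
  using mult_mono[of x x \<one> y] by simp

lemma one_le_meet: "\<one> \<preceq> x \<Longrightarrow> \<one> \<preceq> y \<Longrightarrow> \<one> \<preceq> x \<^bold>\<sqinter> y"
  by (rule meet_greatest)

lemma one_le_pow: "\<one> \<preceq> x \<Longrightarrow> \<one> \<preceq> x [^] (n::nat)"
  by (induction n) (auto intro: one_le_mult)

lemma pow_mono: "x \<preceq> y \<Longrightarrow> x [^] (n::nat) \<preceq> y [^] n"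
  by (induction n) (auto intro: mult_mono)

lemma le_pow: "\<one> \<preceq> x \<Longrightarrow> 0 < n \<Longrightarrow> x \<preceq> x [^] (n::nat)"
proof (cases n)
  case (Suc m)
  assume "\<one> \<preceq> x"
  then show ?thesis
    using mult_mono[of \<one> "x [^] m" x x] by (auto simp: Suc one_le_pow dest: leq_closed)
qed simp

lemma one_le_unit [simp]: "\<one> \<preceq> \<u>"
  using wunit_nonneg by (simp add: leq_def)

text \<open>Expanding the right-hand side by distributivity leaves a meet of three elements; the
  first two lie above \<open>x\<close> and the third is \<open>y \<otimes> z\<close>.\<close>

lemma meet_mult_le:
  assumes "\<one> \<preceq> x" "\<one> \<preceq> y" "\<one> \<preceq> z"
  shows "x \<^bold>\<sqinter> (y \<otimes> z) \<preceq> (x \<^bold>\<sqinter> y) \<otimes> (x \<^bold>\<sqinter> z)"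
proof -
  note [simp] = assms[THEN leq_closed(2)]
  have "(x \<^bold>\<sqinter> y) \<otimes> (x \<^bold>\<sqinter> z) = (x \<otimes> (x \<^bold>\<sqinter> z)) \<^bold>\<sqinter> (y \<otimes> (x \<^bold>\<sqinter> z))"
    by (simp add: meet_mult)
  also have "y \<otimes> (x \<^bold>\<sqinter> z) = (y \<otimes> x) \<^bold>\<sqinter> (y \<otimes> z)"
    using meet_mult[of x z y] by (simp add: m_comm)
  finally have eq: "(x \<^bold>\<sqinter> y) \<otimes> (x \<^bold>\<sqinter> z) = (x \<otimes> (x \<^bold>\<sqinter> z)) \<^bold>\<sqinter> ((y \<otimes> x) \<^bold>\<sqinter> (y \<otimes> z))" .
  have "x \<^bold>\<sqinter> (y \<otimes> z) \<preceq> x" by simp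
  moreover have "x \<preceq> x \<otimes> (x \<^bold>\<sqinter> z)" using assms by (simp add: le_mult one_le_meet)
  moreover have "x \<preceq> y \<otimes> x" using mult_mono[of \<one> y x x] assms by simp
  ultimately have "x \<^bold>\<sqinter> (y \<otimes> z) \<preceq> x \<otimes> (x \<^bold>\<sqinter> z)" "x \<^bold>\<sqinter> (y \<otimes> z) \<preceq> y \<otimes> x"
    by (blast intro: leq_trans)+
  then show ?thesis unfolding eq by (simp add: meet_greatest)
qed

section \<open>Positive parts, disjointness and powers\<close>

lemma pos_ge: "x \<in> carrier G \<Longrightarrow> x \<preceq> pos x" and one_le_pos [simp]: "x \<in> carrier G \<Longrightarrow> \<one> \<preceq> pos x"
  by (simp_all add: pos_def)

lemma pos_least: "x \<preceq> y \<Longrightarrow> \<one> \<preceq> y \<Longrightarrow> pos x \<preceq> y"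
  unfolding pos_def by (rule join_least)

lemma pos_mono: "x \<preceq> y \<Longrightarrow> pos x \<preceq> pos y"
  unfolding pos_def by (rule join_mono) auto

lemma pos_of_pos: "\<one> \<preceq> x \<Longrightarrow> pos x = x"
  by (metis join_absorb join_commute leq_closed pos_def)

lemma pos_eq_one_iff: "x \<in> carrier G \<Longrightarrow> pos x = \<one> \<longleftrightarrow> x \<preceq> \<one>"
  by (metis join_absorb leq_refl one_closed pos_def pos_ge)

lemma pos_mult_le: "x \<in> carrier G \<Longrightarrow> y \<in> carrier G \<Longrightarrow> pos (x \<otimes> y) \<preceq> pos x \<otimes> pos y"
  by (intro pos_least mult_mono pos_ge one_le_mult) auto

lemma pos_mult_neg: "x \<in> carrier G \<Longrightarrow> pos x = x \<otimes> pos (inv x)"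
  using join_mult[of "inv x" \<one> x] by (simp add: pos_def join_commute m_comm)

text \<open>Factoring \<open>pos (inv x)\<close> out of both sides leaves the meet of
  \<open>x\<close> with the neutral element, which is the inverse of
  \<open>pos (inv x)\<close>.\<close>

lemma pos_meet_neg:
  assumes "x \<in> carrier G" shows "pos x \<^bold>\<sqinter> pos (inv x) = \<one>"
proof -
  have inv: "inv (x \<^bold>\<sqinter> \<one>) = pos (inv x)" using assms by (simp add: inv_meet pos_def)
  have "pos x \<^bold>\<sqinter> pos (inv x) = (x \<^bold>\<sqinter> \<one>) \<otimes> pos (inv x)"
    using assms by (simp add: meet_mult flip: pos_mult_neg)
  then show ?thesis using assms by (simp flip: inv)
qed

lemma disjoint_mult:
  assumes "\<one> \<preceq> x" "\<one> \<preceq> y" "\<one> \<preceq> z" "x \<^bold>\<sqinter> y = \<one>" "x \<^bold>\<sqinter> z = \<one>"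
  shows "x \<^bold>\<sqinter> (y \<otimes> z) = \<one>"
proof (rule leq_antisym)
  show "x \<^bold>\<sqinter> (y \<otimes> z) \<preceq> \<one>" using meet_mult_le[OF assms(1-3)] assms by simp
qed (use assms in \<open>auto intro: one_le_meet one_le_mult\<close>)

lemma disjoint_pow:
  assumes "\<one> \<preceq> x" "\<one> \<preceq> y" "x \<^bold>\<sqinter> y = \<one>" shows "x \<^bold>\<sqinter> y [^] (n::nat) = \<one>"
proof (induction n)
  case 0
  then show ?case using assms by (metis meet_absorb meet_commute leq_closed nat_pow_0)
next
  case (Suc n)
  then show ?case using assms by (simp add: disjoint_mult one_le_pow)
qed

lemma disjoint_mono:
  assumes "\<one> \<preceq> x" "x \<preceq> x'" "\<one> \<preceq> y" "y \<preceq> y'" "x' \<^bold>\<sqinter> y' = \<one>" shows "x \<^bold>\<sqinter> y = \<one>"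
  using assms meet_mono[of x x' y y'] by (auto intro: leq_antisym one_le_meet)

text \<open>Powers of the disjoint elements \<open>pos x\<close> and \<open>pos (inv x)\<close> stay
  disjoint, so their join is their product; cancelling \<open>pos (inv x) [^] n\<close> leaves the
  claim.\<close>

lemma pos_pow:
  assumes "x \<in> carrier G" shows "pos (x [^] (n::nat)) = pos x [^] n"
proof -
  let ?a = "pos x [^] n" and ?b = "pos (inv x) [^] n"
  have "?b \<^bold>\<sqinter> pos x = \<one>"
    using assms disjoint_pow[of "pos x" "pos (inv x)" n] by (simp add: pos_meet_neg meet_commute)
  then have "?b \<^bold>\<sqinter> ?a = \<one>" using assms by (intro disjoint_pow) (auto intro: one_le_pow)
  then have join: "?b \<^bold>\<squnion> ?a = ?b \<otimes> ?a" using join_meet_mult[of ?b ?a] assms by simp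
  have "pos x = x \<otimes> pos (inv x)" using assms by (rule pos_mult_neg)
  then have a: "?a = x [^] n \<otimes> ?b" using assms by (simp add: nat_pow_distrib)
  have "pos (x [^] n) \<otimes> ?b = (x [^] n \<otimes> ?b) \<^bold>\<squnion> ?b"
    using assms by (simp add: pos_def[of "x [^] n"] join_mult)
  also have "\<dots> = ?a \<otimes> ?b" using assms join by (simp add: join_commute m_comm flip: a)
  finally show ?thesis using assms by simp
qed

lemma join_as_pos: "x \<in> carrier G \<Longrightarrow> y \<in> carrier G \<Longrightarrow> x \<^bold>\<squnion> y = pos (x \<otimes> inv y) \<otimes> y"
  by (simp add: pos_def join_mult m_assoc)

lemma join_pow:
  assumes "x \<in> carrier G" "y \<in> carrier G"
  shows "(x \<^bold>\<squnion> y) [^] (n::nat) = x [^] n \<^bold>\<squnion> y [^] n"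
proof -
  have "(x \<^bold>\<squnion> y) [^] n = pos ((x \<otimes> inv y) [^] n) \<otimes> y [^] n"
    using assms by (simp add: join_as_pos nat_pow_distrib flip: pos_pow)
  also have "(x \<otimes> inv y) [^] n = x [^] n \<otimes> inv (y [^] n)"
    using assms by (simp add: nat_pow_distrib nat_pow_inv)
  finally show ?thesis using assms by (simp add: join_as_pos)
qed

lemma meet_pow:
  assumes "x \<in> carrier G" "y \<in> carrier G"
  shows "(x \<^bold>\<sqinter> y) [^] (n::nat) = x [^] n \<^bold>\<sqinter> y [^] n"
proof -
  have "(inv x \<^bold>\<squnion> inv y) [^] n = inv (x [^] n) \<^bold>\<squnion> inv (y [^] n)"
    using assms by (simp add: join_pow nat_pow_inv)
  then have "inv ((x \<^bold>\<sqinter> y) [^] n) = inv (x [^] n \<^bold>\<sqinter> y [^] n)"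
    using assms by (simp add: inv_meet flip: nat_pow_inv)
  then show ?thesis using assms by (metis inv_inv meet_closed nat_pow_closed)
qed

end

section \<open>Intrinsic description of W-kernels\<close>

text \<open>\<open>pos (x [^] n \<otimes> inv y) \<in> K\<close> says that \<open>x [^] n\<close> is
  at most \<open>y\<close> modulo \<open>K\<close>. The last two conditions are thus the archimedean
  law and the weakness of the unit in the quotient, stated for positive representatives.\<close>

locale W_ideal = W_object +
  fixes K
  assumes subgroup: "subgroup K G"
    and convex: "x \<in> K \<Longrightarrow> \<one> \<preceq> y \<Longrightarrow> y \<preceq> x \<Longrightarrow> y \<in> K"
    and pos_in: "x \<in> K \<Longrightarrow> pos x \<in> K"
    and arch_quot: "\<one> \<preceq> x \<Longrightarrow> y \<in> carrier G \<Longrightarrow> (\<And>n::nat. pos (x [^] n \<otimes> inv y) \<in> K) \<Longrightarrow> x \<in> K"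
    and weak_quot: "\<one> \<preceq> x \<Longrightarrow> x \<^bold>\<sqinter> \<u> \<in> K \<Longrightarrow> x \<in> K"

context W_morphism
begin

lemma closed [simp, intro]: "x \<in> carrier G \<Longrightarrow> \<theta> x \<in> carrier H"
  using hom by (auto simp: hom_def)

sublocale group_hom G H \<theta>
  by unfold_locales (rule hom)

lemma mono: "dom.leq x y \<Longrightarrow> cod.leq (\<theta> x) (\<theta> y)"
  by (metis closed cod.join_left dom.join_absorb dom.leq_closed join)

lemma map_pos: "x \<in> carrier G \<Longrightarrow> \<theta> (dom.pos x) = cod.pos (\<theta> x)"
  by (simp add: dom.pos_def cod.pos_def join)

lemma W_ideal_kernel: "W_ideal G (kernel G H \<theta>)"
proof (intro W_ideal.intro W_ideal_axioms.intro)
  show "subgroup (kernel G H \<theta>) G" by (rule subgroup_kernel)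
next
  fix x y assume "x \<in> kernel G H \<theta>" "dom.leq \<one>\<^bsub>G\<^esub> y" "dom.leq y x"
  then have "\<theta> y = \<one>\<^bsub>H\<^esub>" using mono[of "\<one>\<^bsub>G\<^esub>" y] mono[of y x] by
    (auto simp: kernel_def intro: cod.leq_antisym)
  then show "y \<in> kernel G H \<theta>" using \<open>dom.leq y x\<close> by (auto simp: kernel_def dest: dom.leq_closed)
next
  fix x assume "x \<in> kernel G H \<theta>"
  then show "dom.pos x \<in> kernel G H \<theta>" by (auto simp: kernel_def map_pos cod.pos_of_pos)
next
  fix x y assume xy: "dom.leq \<one>\<^bsub>G\<^esub> x" "y \<in> carrier G"
    and K: "\<And>n::nat. dom.pos (x [^]\<^bsub>G\<^esub> n \<otimes>\<^bsub>G\<^esub> inv\<^bsub>G\<^esub> y) \<in> kernel G H \<theta>"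
  from xy have [simp]: "x \<in> carrier G" by (auto dest: dom.leq_closed)
  have "cod.leq (\<theta> x [^]\<^bsub>H\<^esub> n) (\<theta> y)" for n :: nat
    using K[of n] xy(2) by (subst cod.leq_iff_diff)
      (simp_all add: kernel_def map_pos cod.pos_eq_one_iff hom_nat_pow)
  then have "\<theta> x = \<one>\<^bsub>H\<^esub>"
    using cod.archimedean[of "\<theta> x" "\<theta> y"] xy(2) mono[OF xy(1)] by (simp add: cod.leq_def)
  then show "x \<in> kernel G H \<theta>" by (simp add: kernel_def)
next
  fix x assume x: "dom.leq \<one>\<^bsub>G\<^esub> x" "x \<sqinter>\<^bsub>ord_of G\<^esub> wunit G \<in> kernel G H \<theta>"
  then have [simp]: "x \<in> carrier G" by (auto dest: dom.leq_closed)
  have "\<theta> x = \<one>\<^bsub>H\<^esub>"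
    by (rule cod.wunit_weak) (use x mono[OF x(1)] in \<open>auto simp: kernel_def meet unit cod.leq_def\<close>)
  then show "x \<in> kernel G H \<theta>" by (simp add: kernel_def)
qed (rule dom.W_object_axioms)

end

section \<open>The quotient W-object of an ideal\<close>

context W_ideal
begin

sublocale subgroup K G
  by (rule subgroup)

lemma split_pos: "z \<in> carrier G \<Longrightarrow> z = pos z \<otimes> inv (pos (inv z))"
  by (simp add: pos_mult_neg[of z] m_assoc)

lemma in_iff_pos: "z \<in> carrier G \<Longrightarrow> z \<in> K \<longleftrightarrow> pos z \<in> K \<and> pos (inv z) \<in> K"
  by (metis m_closed m_inv_closed pos_in split_pos)

lemma pow_closed_K: "x \<in> K \<Longrightarrow> x [^] (n::nat) \<in> K"
  by (induction n) auto

text \<open>The order of the quotient group, pulled back to representatives.\<close>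

definition le_mod (infix "\<preceq>\<^sub>K" 50) where
  "x \<preceq>\<^sub>K y \<longleftrightarrow> x \<in> carrier G \<and> y \<in> carrier G \<and> pos (x \<otimes> inv y) \<in> K"

lemma leq_imp_le_mod: "x \<preceq> y \<Longrightarrow> x \<preceq>\<^sub>K y"
  using leq_iff_diff[of x y] pos_eq_one_iff[of "x \<otimes> inv y"] leq_closed[of x y] by
    (auto simp: le_mod_def)

lemma le_mod_trans: "x \<preceq>\<^sub>K y \<Longrightarrow> y \<preceq>\<^sub>K z \<Longrightarrow> x \<preceq>\<^sub>K z"
proof -
  assume *: "x \<preceq>\<^sub>K y" "y \<preceq>\<^sub>K z"
  then have c: "x \<in> carrier G" "y \<in> carrier G" "z \<in> carrier G" by (auto simp: le_mod_def)
  then have "(x \<otimes> inv y) \<otimes> (y \<otimes> inv z) = x \<otimes> inv z" by (simp add: m_assoc) (simp flip: m_assoc)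
  then have "pos (x \<otimes> inv z) \<preceq> pos (x \<otimes> inv y) \<otimes> pos (y \<otimes> inv z)"
    using pos_mult_le[of "x \<otimes> inv y" "y \<otimes> inv z"] c by simp
  then show ?thesis using * c by (auto simp: le_mod_def intro: convex[rotated 2])
qed

lemma le_mod_antisym: "x \<preceq>\<^sub>K y \<Longrightarrow> y \<preceq>\<^sub>K x \<Longrightarrow> x \<otimes> inv y \<in> K"
  by (subst in_iff_pos) (auto simp: le_mod_def inv_mult_group)

text \<open>The product of the two positive parts bounds both differences, and it lies in
  \<open>K\<close>.\<close>

lemma le_mod_join: "x \<preceq>\<^sub>K z \<Longrightarrow> y \<preceq>\<^sub>K z \<Longrightarrow> x \<^bold>\<squnion> y \<preceq>\<^sub>K z"
proof -
  assume *: "x \<preceq>\<^sub>K z" "y \<preceq>\<^sub>K z"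
  then have c [simp]: "x \<in> carrier G" "y \<in> carrier G" "z \<in> carrier G" by (auto simp: le_mod_def)
  let ?p = "pos (x \<otimes> inv z)" and ?q = "pos (y \<otimes> inv z)"
  have "x \<otimes> inv z \<preceq> ?p \<otimes> ?q"
    using mult_mono[of "x \<otimes> inv z" ?p \<one> ?q] by (simp add: pos_ge)
  moreover have "y \<otimes> inv z \<preceq> ?p \<otimes> ?q"
    using mult_mono[of \<one> ?p "y \<otimes> inv z" ?q] by (simp add: pos_ge)
  ultimately have "pos ((x \<^bold>\<squnion> y) \<otimes> inv z) \<preceq> ?p \<otimes> ?q"
    by (auto simp: join_mult intro!: pos_least join_least one_le_mult)
  then show ?thesis using * by (auto simp: le_mod_def intro: convex[rotated 2])
qed

lemma le_mod_inv: "x \<preceq>\<^sub>K y \<Longrightarrow> inv y \<preceq>\<^sub>K inv x"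
  by (simp add: le_mod_def m_comm)

lemma le_mod_meet: "z \<preceq>\<^sub>K x \<Longrightarrow> z \<preceq>\<^sub>K y \<Longrightarrow> z \<preceq>\<^sub>K x \<^bold>\<sqinter> y"
proof -
  assume *: "z \<preceq>\<^sub>K x" "z \<preceq>\<^sub>K y"
  then have c [simp]: "x \<in> carrier G" "y \<in> carrier G" "z \<in> carrier G" by (auto simp: le_mod_def)
  have "inv (x \<^bold>\<sqinter> y) \<preceq>\<^sub>K inv z" using * by (simp add: inv_meet le_mod_join le_mod_inv)
  from le_mod_inv[OF this] show ?thesis by simp
qed

lemma le_mod_mult: "x \<preceq>\<^sub>K y \<Longrightarrow> z \<in> carrier G \<Longrightarrow> x \<otimes> z \<preceq>\<^sub>K y \<otimes> z"
proof -
  assume *: "x \<preceq>\<^sub>K y" "z \<in> carrier G"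
  then have c [simp]: "x \<in> carrier G" "y \<in> carrier G" "z \<in> carrier G" by (auto simp: le_mod_def)
  have "(x \<otimes> z) \<otimes> inv (y \<otimes> z) = x \<otimes> inv y"
    by (simp add: inv_mult_group m_assoc) (simp flip: m_assoc)
  then show ?thesis using * by (simp add: le_mod_def)
qed

text \<open>Cosets are compared through some pair of representatives; by \<open>quot_wle\<close> any
  pair gives the same answer.\<close>

definition quot :: "'a set wgroup" where
  "quot = \<lparr>carrier = (\<lambda>x. K #> x) ` carrier G, monoid.mult = set_mult G, one = K,
     wle = (\<lambda>A B. \<exists>a\<in>A. \<exists>b\<in>B. a \<preceq>\<^sub>K b), wunit = K #> \<u>\<rparr>"

lemma coset_eq_iff: "x \<in> carrier G \<Longrightarrow> y \<in> carrier G \<Longrightarrow> K #> x = K #> y \<longleftrightarrow> x \<otimes> inv y \<in> K"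
  using repr_independence[of x K y, OF _ _ subgroup] rcos_self[of x, OF _ subgroup]
    rcos_module[of y x] is_group by auto

lemma coset_eqI: "x \<preceq>\<^sub>K y \<Longrightarrow> y \<preceq>\<^sub>K x \<Longrightarrow> K #> x = K #> y"
  using le_mod_antisym by (subst coset_eq_iff) (auto simp: le_mod_def)

lemma in_coset_le_mod: "a \<in> K #> x \<Longrightarrow> x \<in> carrier G \<Longrightarrow> a \<preceq>\<^sub>K x \<and> x \<preceq>\<^sub>K a"
proof -
  assume a: "a \<in> K #> x" "x \<in> carrier G"
  then have [simp]: "a \<in> carrier G" using r_coset_subset_G[OF subset] by blast
  have "K #> x = K #> a" using repr_independence[OF a subgroup] .
  then have "a \<otimes> inv x \<in> K" using coset_eq_iff[of a x] a by simp
  then show ?thesis using a in_iff_pos[of "a \<otimes> inv x"] by (simp add: le_mod_def inv_mult_group)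
qed

lemma quot_simps [simp]:
  "carrier quot = (\<lambda>x. K #> x) ` carrier G" "\<one>\<^bsub>quot\<^esub> = K" "wunit quot = K #> \<u>"
  by (simp_all add: quot_def)

lemma quot_mult [simp]:
  "x \<in> carrier G \<Longrightarrow> y \<in> carrier G \<Longrightarrow> (K #> x) \<otimes>\<^bsub>quot\<^esub> (K #> y) = K #> (x \<otimes> y)"
  by (simp add: quot_def normal.rcos_sum subgroup subgroup_imp_normal)

lemma quot_wle [simp]:
  "x \<in> carrier G \<Longrightarrow> y \<in> carrier G \<Longrightarrow> wle quot (K #> x) (K #> y) \<longleftrightarrow> x \<preceq>\<^sub>K y"
  unfolding quot_def using in_coset_le_mod rcos_self[OF _ subgroup] le_mod_trans by simp metis

lemma coset_one: "K #> \<one> = K"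
  by (simp add: coset_mult_one subset)

lemma coset_eq_K: "x \<in> carrier G \<Longrightarrow> K #> x = K \<longleftrightarrow> x \<in> K"
  using coset_eq_iff[of x \<one>] by (simp add: coset_one)

lemma quot_wle_K [simp]: "x \<in> carrier G \<Longrightarrow> wle quot K (K #> x) \<longleftrightarrow> \<one> \<preceq>\<^sub>K x"
  using quot_wle[of \<one> x] by (simp add: coset_one)

lemma comm_group_quot: "comm_group quot"
proof (rule comm_groupI)
  show "\<one>\<^bsub>quot\<^esub> \<in> carrier quot" using coset_one by (auto intro: image_eqI[of _ _ \<one>])
next
  fix A assume "A \<in> carrier quot"
  then obtain x where "A = K #> x" "x \<in> carrier G" by auto
  then show "\<one>\<^bsub>quot\<^esub> \<otimes>\<^bsub>quot\<^esub> A = A" "\<exists>B\<in>carrier quot. B \<otimes>\<^bsub>quot\<^esub> A = \<one>\<^bsub>quot\<^esub>"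
    using quot_mult[of \<one> x] by (auto simp: coset_one intro!: bexI[of _ "inv x"])
qed (auto simp: m_ac)

lemma
  shows lattice_quot: "lattice (ord_of quot)"
    and join_quot: "x \<in> carrier G \<Longrightarrow> y \<in> carrier G \<Longrightarrow>
      (K #> x) \<squnion>\<^bsub>ord_of quot\<^esub> (K #> y) = K #> (x \<^bold>\<squnion> y)"
    and meet_quot: "x \<in> carrier G \<Longrightarrow> y \<in> carrier G \<Longrightarrow>
      (K #> x) \<sqinter>\<^bsub>ord_of quot\<^esub> (K #> y) = K #> (x \<^bold>\<sqinter> y)"
proof -
  interpret P: partial_order "ord_of quot"
  proof unfold_locales
    fix A B C assume "A \<sqsubseteq>\<^bsub>ord_of quot\<^esub> B" "B \<sqsubseteq>\<^bsub>ord_of quot\<^esub> C" "A \<in> carrier (ord_of quot)"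
      "B \<in> carrier (ord_of quot)" "C \<in> carrier (ord_of quot)"
    then show "A \<sqsubseteq>\<^bsub>ord_of quot\<^esub> C" by (auto dest: le_mod_trans)
  next
    fix A B assume "A \<sqsubseteq>\<^bsub>ord_of quot\<^esub> B" "B \<sqsubseteq>\<^bsub>ord_of quot\<^esub> A" "A \<in> carrier (ord_of quot)"
      "B \<in> carrier (ord_of quot)"
    then show "A .=\<^bsub>ord_of quot\<^esub> B" by (simp, elim imageE) (simp, rule coset_eqI)
  qed (auto simp: leq_imp_le_mod)
  have lub: "is_lub (ord_of quot) (K #> (x \<^bold>\<squnion> y)) {K #> x, K #> y}"
    if "x \<in> carrier G" "y \<in> carrier G" for x y
  proof (rule least_UpperI)
    fix A assume A: "A \<in> Upper (ord_of quot) {K #> x, K #> y}"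
    then have "A \<in> carrier quot" by (simp add: Upper_def)
    then obtain z where z: "A = K #> z" "z \<in> carrier G" unfolding quot_simps by (rule imageE)
    with A that have "x \<preceq>\<^sub>K z" "y \<preceq>\<^sub>K z" by (simp_all add: Upper_def)
    with z show "K #> (x \<^bold>\<squnion> y) \<sqsubseteq>\<^bsub>ord_of quot\<^esub> A" using that by (simp add: le_mod_join)
  qed (use that in \<open>auto simp: leq_imp_le_mod\<close>)
  have glb: "is_glb (ord_of quot) (K #> (x \<^bold>\<sqinter> y)) {K #> x, K #> y}"
    if "x \<in> carrier G" "y \<in> carrier G" for x y
  proof (rule greatest_LowerI)
    fix A assume A: "A \<in> Lower (ord_of quot) {K #> x, K #> y}"
    then have "A \<in> carrier quot" by (simp add: Lower_def)
    then obtain z where z: "A = K #> z" "z \<in> carrier G" unfolding quot_simps by (rule imageE)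
    with A that have "z \<preceq>\<^sub>K x" "z \<preceq>\<^sub>K y" by (simp_all add: Lower_def)
    with z show "A \<sqsubseteq>\<^bsub>ord_of quot\<^esub> K #> (x \<^bold>\<sqinter> y)" using that by (simp add: le_mod_meet)
  qed (use that in \<open>auto simp: leq_imp_le_mod\<close>)
  show "lattice (ord_of quot)"
    by unfold_locales (simp, blast intro: lub glb)+
  show "(K #> x) \<squnion>\<^bsub>ord_of quot\<^esub> (K #> y) = K #> (x \<^bold>\<squnion> y)"
    "(K #> x) \<sqinter>\<^bsub>ord_of quot\<^esub> (K #> y) = K #> (x \<^bold>\<sqinter> y)"
    if "x \<in> carrier G" "y \<in> carrier G" for x y
    using P.join_eqI[OF lub] P.meet_eqI[OF glb] that by auto
qed

lemma quot_pow:
  assumes "x \<in> carrier G" shows "(K #> x) [^]\<^bsub>quot\<^esub> (n::nat) = K #> (x [^] n)"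
  using assms by (induction n) (auto simp: coset_one)

lemma W_object_quot: "W_object quot"
proof (intro W_object.intro W_object_axioms.intro)
  fix A B assume "A \<in> carrier quot" "B \<in> carrier quot" "wle quot \<one>\<^bsub>quot\<^esub> A"
    "\<forall>n::nat. wle quot (A [^]\<^bsub>quot\<^esub> n) B"
  then obtain x y where xy [simp]: "A = K #> x" "B = K #> y" "x \<in> carrier G" "y \<in> carrier G"
    and x: "pos (inv x) \<in> K" and le: "\<And>n::nat. x [^] n \<preceq>\<^sub>K y"
    by (auto simp: quot_pow le_mod_def)
  \<comment> \<open>\<open>x\<close> is positive only modulo \<open>K\<close>, whereas
    \<open>arch_quot\<close> asks for a truly positive element. Passing to \<open>pos x\<close>
    costs powers of \<open>pos (inv x)\<close>, which lie in \<open>K\<close>.\<close>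
  have "pos (pos x [^] n \<otimes> inv y) \<in> K" for n :: nat
  proof -
    have "pos x [^] n \<otimes> inv y = (x [^] n \<otimes> inv y) \<otimes> pos (inv x) [^] n"
      by (simp add: pos_mult_neg[of x] nat_pow_distrib m_ac)
    then have "pos (pos x [^] n \<otimes> inv y) \<preceq> pos (x [^] n \<otimes> inv y) \<otimes> pos (inv x) [^] n"
      using pos_mult_le[of "x [^] n \<otimes> inv y" "pos (inv x) [^] n"]
      by (simp add: pos_of_pos one_le_pow)
    then show ?thesis using le[of n] x by
      (auto simp: le_mod_def pow_closed_K intro: convex[rotated 2])
  qed
  then have "pos x \<in> K" by (intro arch_quot[of "pos x" y]) auto
  then show "A = \<one>\<^bsub>quot\<^esub>" using x in_iff_pos[of x] by (simp add: coset_eq_K)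
next
  fix A assume "A \<in> carrier quot" "wle quot \<one>\<^bsub>quot\<^esub> A" "A \<sqinter>\<^bsub>ord_of quot\<^esub> wunit quot = \<one>\<^bsub>quot\<^esub>"
  then obtain x where x [simp]: "A = K #> x" "x \<in> carrier G"
    and K: "pos (inv x) \<in> K" "x \<^bold>\<sqinter> \<u> \<in> K"
    by (auto simp: meet_quot coset_eq_K le_mod_def)
  \<comment> \<open>Again \<open>x\<close> is replaced by
    \<open>x \<otimes> pos (inv x) = pos x\<close>, at the cost of a factor in
    \<open>K\<close>.\<close>
  have "pos x \<^bold>\<sqinter> \<u> \<preceq> (x \<^bold>\<sqinter> \<u>) \<otimes> pos (inv x)"
    by (auto simp: meet_mult intro!: meet_mono le_mult simp flip: pos_mult_neg)
  then have "pos x \<^bold>\<sqinter> \<u> \<in> K"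
    by (rule convex[rotated 2]) (use K in \<open>auto intro: one_le_meet\<close>)
  then have "pos x \<in> K" using weak_quot[of "pos x"] by simp
  then show "A = \<one>\<^bsub>quot\<^esub>" using K in_iff_pos[of x] by (simp add: coset_eq_K)
qed (auto simp: comm_group_quot lattice_quot leq_imp_le_mod le_mod_mult)

lemma W_morphism_quot: "W_morphism G quot (\<lambda>x. K #> x)"
  by (intro W_morphism.intro W_morphism_axioms.intro W_object_quot W_object_axioms)
    (auto simp: join_quot meet_quot hom_def)

text \<open>The quotient lives on sets of elements; \<open>W_kernelI\<close> moves the codomain back
  to the type of \<open>G\<close>.\<close>

lemma W_kernel: "W_kernel G K"
proof -
  have "kernel G quot (\<lambda>x. K #> x) = K" using subset
    by (simp add: kernel_def coset_eq_K cong: conj_cong) blast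
  then show ?thesis using W_kernelI[OF W_morphism_quot] by simp
qed

end

lemma W_kernel_iff_W_ideal: "W_kernel G K \<longleftrightarrow> W_ideal G K"
  by (metis W_ideal.W_kernel W_kernel_def W_morphism.W_ideal_kernel)

section \<open>The frame of W-kernels\<close>

lemma (in W_ideal) meet_pow_in:
  assumes "\<one> \<preceq> x" "\<one> \<preceq> y" "x \<^bold>\<sqinter> y \<in> K" shows "x \<^bold>\<sqinter> y [^] (n::nat) \<in> K"
proof (induction n)
  case 0
  then show ?case using assms meet_absorb[of \<one> x] by (simp add: meet_commute leq_closed)
next
  case (Suc n)
  have "x \<^bold>\<sqinter> y [^] Suc n \<preceq> (x \<^bold>\<sqinter> y [^] n) \<otimes> (x \<^bold>\<sqinter> y)"
    using meet_mult_le[of x "y [^] n" y] assms by (simp add: one_le_pow)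
  then show ?case
    using Suc assms by (elim convex[rotated 2]) (simp_all add: one_le_meet one_le_mult one_le_pow)
qed

context W_object
begin

text \<open>The Heyting implication from the kernel generated by \<open>y\<close> to \<open>M\<close>.\<close>
definition residual :: "'a set \<Rightarrow> 'a \<Rightarrow> 'a set" where
  "residual M y = {x. \<exists>z. \<one> \<preceq> z \<and> inv z \<preceq> x \<and> x \<preceq> z \<and> z \<^bold>\<sqinter> y \<in> M}"

text \<open>The witness \<open>z\<close> in the definition bounds the absolute value of
  \<open>x\<close>; for positive \<open>x\<close> it can be \<open>x\<close> itself.\<close>

lemma in_residual_iff:
  assumes "W_ideal G M" "\<one> \<preceq> y" "\<one> \<preceq> x"
  shows "x \<in> residual M y \<longleftrightarrow> x \<^bold>\<sqinter> y \<in> M"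
proof -
  interpret W_ideal G M by fact
  have [simp]: "x \<in> carrier G" "y \<in> carrier G" using assms by (auto dest: leq_closed)
  show ?thesis
  proof
    assume "x \<in> residual M y"
    then obtain z where "x \<preceq> z" "z \<^bold>\<sqinter> y \<in> M" by (auto simp: residual_def)
    moreover from this have "x \<^bold>\<sqinter> y \<preceq> z \<^bold>\<sqinter> y" by (intro meet_mono) auto
    ultimately show "x \<^bold>\<sqinter> y \<in> M" using convex assms by (blast intro: one_le_meet)
  next
    assume "x \<^bold>\<sqinter> y \<in> M"
    moreover have "inv x \<preceq> x" using assms(3) inv_antimono[of \<one> x] by (auto intro: leq_trans)
    ultimately show "x \<in> residual M y" using assms unfolding residual_def by auto
  qed
qed

text \<open>This lets a meet condition on a generated kernel be checked on its generators alone.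
  Products are handled by \<open>meet_mult_le\<close>; the archimedean condition is the delicate
  one.\<close>

lemma W_ideal_residual:
  assumes "W_ideal G M" "\<one> \<preceq> y"
  shows "W_ideal G (residual M y)"
proof -
  interpret W_ideal G M by fact
  note iff = in_residual_iff[OF assms]
  have y [simp]: "y \<in> carrier G" using assms by (auto dest: leq_closed)
  show ?thesis
  proof (intro W_ideal.intro W_ideal_axioms.intro W_object_axioms)
    show "subgroup (residual M y) G"
    proof (rule subgroupI)
      show "residual M y \<subseteq> carrier G" by (auto simp: residual_def dest: leq_closed)
      have "\<one> \<in> residual M y" using meet_absorb[OF assms(2)] by (subst iff) auto
      then show "residual M y \<noteq> {}" by auto
    next
      fix x assume "x \<in> residual M y"
      then obtain z where z: "\<one> \<preceq> z" "inv z \<preceq> x" "x \<preceq> z" "z \<^bold>\<sqinter> y \<in> M"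
        unfolding residual_def by blast
      then have "x \<in> carrier G" "z \<in> carrier G" by (auto dest: leq_closed)
      with z have "inv z \<preceq> inv x" "inv x \<preceq> z" by (auto simp: inv_le_iff intro: inv_antimono)
      then show "inv x \<in> residual M y" using z unfolding residual_def by blast
    next
      fix x x' assume "x \<in> residual M y" "x' \<in> residual M y"
      then obtain z z' where z: "\<one> \<preceq> z" "inv z \<preceq> x" "x \<preceq> z" "z \<^bold>\<sqinter> y \<in> M"
        and z': "\<one> \<preceq> z'" "inv z' \<preceq> x'" "x' \<preceq> z'" "z' \<^bold>\<sqinter> y \<in> M"
        unfolding residual_def by blast
      then have [simp]: "z \<in> carrier G" "z' \<in> carrier G" by (auto dest: leq_closed)
      have "inv (z \<otimes> z') \<preceq> x \<otimes> x'" "x \<otimes> x' \<preceq> z \<otimes> z'"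
        using mult_mono[OF z(2) z'(2)] mult_mono[OF z(3) z'(3)] by (simp_all add: inv_mult)
      moreover have "(z \<otimes> z') \<^bold>\<sqinter> y \<preceq> (z \<^bold>\<sqinter> y) \<otimes> (z' \<^bold>\<sqinter> y)"
        using meet_mult_le[OF assms(2) z(1) z'(1)] by (simp add: meet_commute[of y])
      then have "(z \<otimes> z') \<^bold>\<sqinter> y \<in> M"
        by (rule convex[rotated 2]) (use z z' assms in \<open>auto intro: one_le_meet one_le_mult\<close>)
      ultimately show "x \<otimes> x' \<in> residual M y"
        using one_le_mult[OF z(1) z'(1)] unfolding residual_def by blast
    qed
  next
    fix x v assume "x \<in> residual M y" "\<one> \<preceq> v" "v \<preceq> x"
    then obtain z where "\<one> \<preceq> z" "v \<preceq> z" "z \<^bold>\<sqinter> y \<in> M"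
      unfolding residual_def by (blast intro: leq_trans)
    moreover from this have "v \<^bold>\<sqinter> y \<preceq> z \<^bold>\<sqinter> y" by (intro meet_mono) auto
    ultimately have "v \<^bold>\<sqinter> y \<in> M" using convex assms \<open>\<one> \<preceq> v\<close> by (blast intro: one_le_meet)
    with \<open>\<one> \<preceq> v\<close> show "v \<in> residual M y" by (subst iff)
  next
    fix x assume "x \<in> residual M y"
    then obtain z where z: "\<one> \<preceq> z" "x \<preceq> z" "z \<^bold>\<sqinter> y \<in> M"
      unfolding residual_def by blast
    then have "pos x \<^bold>\<sqinter> y \<preceq> z \<^bold>\<sqinter> y" "x \<in> carrier G"
      by (auto intro!: meet_mono pos_least dest: leq_closed)
    then have "pos x \<^bold>\<sqinter> y \<in> M" using convex[OF z(3)] assms by (simp add: one_le_meet)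
    with \<open>x \<in> carrier G\<close> show "pos x \<in> residual M y" by (subst iff) auto
  next
    fix x v assume x: "\<one> \<preceq> x" and v [simp]: "v \<in> carrier G"
      and R: "\<And>n::nat. pos (x [^] n \<otimes> inv v) \<in> residual M y"
    have [simp]: "x \<in> carrier G" using x by (auto dest: leq_closed)
    let ?w = "x \<^bold>\<sqinter> y" and ?c = "pos v"
    have w: "\<one> \<preceq> ?w" using x assms by (intro one_le_meet)
    \<comment> \<open>The element lies below both \<open>?p\<close> and \<open>y [^] n\<close>,
      whose meet is in \<open>M\<close> by \<open>meet_pow_in\<close>. Replacing \<open>v\<close> by
      \<open>pos v\<close> makes \<open>inv ?c\<close> negative, which the bound by
      \<open>y [^] n\<close> uses.\<close>
    have "pos (?w [^] n \<otimes> inv ?c) \<in> M" for n :: nat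
    proof -
      let ?p = "pos (x [^] n \<otimes> inv v)"
      have "?p \<^bold>\<sqinter> y \<in> M" using R[of n] by (subst (asm) iff) auto
      then have M: "?p \<^bold>\<sqinter> y [^] n \<in> M" using assms by (intro meet_pow_in) auto
      have "?w [^] n \<otimes> inv ?c \<preceq> x [^] n \<otimes> inv v"
        by (intro mult_mono pow_mono inv_antimono pos_ge) auto
      then have 1: "pos (?w [^] n \<otimes> inv ?c) \<preceq> ?p" by (rule pos_mono)
      have "inv ?c \<preceq> \<one>" using inv_antimono[of \<one> ?c] by simp
      then have "?w [^] n \<otimes> inv ?c \<preceq> y [^] n"
        using mult_mono[OF pow_mono[of ?w y n], of "inv ?c" \<one>] by simp
      then have "pos (?w [^] n \<otimes> inv ?c) \<preceq> y [^] n"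
        using assms by (intro pos_least) (auto intro: one_le_pow)
      with 1 have "pos (?w [^] n \<otimes> inv ?c) \<preceq> ?p \<^bold>\<sqinter> y [^] n" by (rule meet_greatest)
      then show ?thesis by (rule convex[OF M, rotated]) simp
    qed
    then have "?w \<in> M" by (rule arch_quot[OF w, rotated]) simp
    then show "x \<in> residual M y" using x by (subst iff)
  next
    fix x assume x: "\<one> \<preceq> x" "x \<^bold>\<sqinter> \<u> \<in> residual M y"
    have [simp]: "x \<in> carrier G" using x by (auto dest: leq_closed)
    have "(x \<^bold>\<sqinter> \<u>) \<^bold>\<sqinter> y \<in> M" using x by (subst (asm) iff) (auto intro: one_le_meet)
    also have "(x \<^bold>\<sqinter> \<u>) \<^bold>\<sqinter> y = (x \<^bold>\<sqinter> y) \<^bold>\<sqinter> \<u>" by (simp add: meet_assoc meet_commute[of \<u>])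
    finally have "x \<^bold>\<sqinter> y \<in> M" using weak_quot[of "x \<^bold>\<sqinter> y"] x assms by (simp add: one_le_meet)
    then show "x \<in> residual M y" using x by (subst iff)
  qed
qed

lemma W_ideal_carrier: "W_ideal G (carrier G)"
  by unfold_locales (auto dest: leq_closed)

lemma W_ideal_Inter:
  assumes "\<K> \<noteq> {}" "\<And>K. K \<in> \<K> \<Longrightarrow> W_ideal G K"
  shows "W_ideal G (\<Inter>\<K>)"
proof (intro W_ideal.intro W_ideal_axioms.intro W_object_axioms)
  show "subgroup (\<Inter>\<K>) G" using assms by (intro subgroups_Inter) (auto intro: W_ideal.subgroup)
next
  fix x y assume "x \<in> \<Inter>\<K>" "\<one> \<preceq> y" "y \<preceq> x"
  then show "y \<in> \<Inter>\<K>" using W_ideal.convex[OF assms(2)] by blast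
next
  fix x assume "x \<in> \<Inter>\<K>"
  then show "pos x \<in> \<Inter>\<K>" using W_ideal.pos_in[OF assms(2)] by blast
next
  fix x y assume "\<one> \<preceq> x" "y \<in> carrier G" "\<And>n::nat. pos (x [^] n \<otimes> inv y) \<in> \<Inter>\<K>"
  then show "x \<in> \<Inter>\<K>" using W_ideal.arch_quot[OF assms(2), of _ x y] by blast
next
  fix x assume "\<one> \<preceq> x" "x \<^bold>\<sqinter> \<u> \<in> \<Inter>\<K>"
  then show "x \<in> \<Inter>\<K>" using W_ideal.weak_quot[OF assms(2), of _ x] by blast
qed

lemma W_ideal_Int:
  assumes "W_ideal G K" "W_ideal G M" shows "W_ideal G (K \<inter> M)"
proof -
  have "W_ideal G (\<Inter>{K, M})" by (rule W_ideal_Inter) (use assms in auto)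
  then show ?thesis by simp
qed

abbreviation gen where "gen \<equiv> W_kernel_gen G"

lemma gen_eq: "gen S = \<Inter>{K. W_ideal G K \<and> S \<subseteq> K}"
  by (simp add: W_kernel_gen_def W_kernel_iff_W_ideal)

lemma W_ideal_gen: "S \<subseteq> carrier G \<Longrightarrow> W_ideal G (gen S)"
  unfolding gen_eq using W_ideal_carrier by (intro W_ideal_Inter) auto

lemma gen_superset: "S \<subseteq> gen S"
  by (auto simp: gen_eq)

lemma gen_least: "W_ideal G K \<Longrightarrow> S \<subseteq> K \<Longrightarrow> gen S \<subseteq> K"
  by (auto simp: gen_eq)

lemma gen_subset_iff: "W_ideal G K \<Longrightarrow> gen S \<subseteq> K \<longleftrightarrow> S \<subseteq> K"
  using gen_least gen_superset by blast

text \<open>Every element is a quotient of its positive and negative parts, so an ideal is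
  determined by its positive elements.\<close>

lemma W_ideal_subset_iff:
  assumes "W_ideal G K" "W_ideal G M"
  shows "K \<subseteq> M \<longleftrightarrow> (\<forall>x\<in>K. \<one> \<preceq> x \<longrightarrow> x \<in> M)"
proof (safe)
  fix x assume *: "\<forall>x\<in>K. \<one> \<preceq> x \<longrightarrow> x \<in> M" and x: "x \<in> K"
  then have c: "x \<in> carrier G" using assms(1) by (meson W_ideal.subgroup subgroup.mem_carrier)
  then have "pos x \<in> K" "pos (inv x) \<in> K" using x W_ideal.in_iff_pos[OF assms(1), of x] by auto
  then show "x \<in> M" using * c W_ideal.in_iff_pos[OF assms(2), of x] by simp
qed auto

text \<open>Residuals are applied twice: first \<open>t\<close> is fixed and the generators
  \<open>s\<close> are extended to all of \<open>gen S\<close>, then \<open>x\<close> is fixed and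
  \<open>t\<close> is extended to \<open>gen T\<close>. An element of both is its own meet.\<close>

lemma gen_Int_subset:
  assumes M: "W_ideal G M" and S: "\<And>s. s \<in> S \<Longrightarrow> \<one> \<preceq> s" and T: "\<And>t. t \<in> T \<Longrightarrow> \<one> \<preceq> t"
    and meet: "\<And>s t. s \<in> S \<Longrightarrow> t \<in> T \<Longrightarrow> s \<^bold>\<sqinter> t \<in> M"
  shows "gen S \<inter> gen T \<subseteq> M"
proof -
  have sub: "S \<subseteq> carrier G" "T \<subseteq> carrier G" using S T by (auto dest: leq_closed)
  have 1: "x \<^bold>\<sqinter> t \<in> M" if "x \<in> gen S" "\<one> \<preceq> x" "t \<in> T" for x t
  proof -
    have "gen S \<subseteq> residual M t"
      using that S T meet M by (intro gen_least W_ideal_residual) (auto simp: in_residual_iff)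
    then show ?thesis using that T M in_residual_iff by blast
  qed
  have 2: "x \<^bold>\<sqinter> y \<in> M" if "x \<in> gen S" "\<one> \<preceq> x" "y \<in> gen T" "\<one> \<preceq> y" for x y
  proof -
    have "t \<^bold>\<sqinter> x \<in> M" if "t \<in> T" for t
      using 1[OF \<open>x \<in> gen S\<close> \<open>\<one> \<preceq> x\<close> that] T[OF that] \<open>\<one> \<preceq> x\<close> meet_commute[of x t]
      by (metis leq_closed(2))
    then have "gen T \<subseteq> residual M x"
      using that T M by (intro gen_least W_ideal_residual) (auto simp: in_residual_iff)
    then show ?thesis using that M in_residual_iff[of M x y] meet_commute[of x y]
      by (metis leq_closed(2) subsetD)
  qed
  have "W_ideal G (gen S \<inter> gen T)"
    using sub by (intro W_ideal_Int W_ideal_gen)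
  moreover have "x \<in> M" if "x \<in> gen S \<inter> gen T" "\<one> \<preceq> x" for x
    using 2[of x x] that meet_absorb[of x x] by (auto dest: leq_closed)
  ultimately show ?thesis using M by (simp add: W_ideal_subset_iff)
qed

section \<open>Joins, meets and top of the Madden frame\<close>

lemma madden_frame_simps [simp]:
  "carrier (madden_frame G) = {K. W_ideal G K}" "eq (madden_frame G) = (=)"
  "le (madden_frame G) = (\<subseteq>)"
  by (simp_all add: madden_frame_def W_kernel_iff_W_ideal)

lemma partial_order_madden_frame: "partial_order (madden_frame G)"
  by unfold_locales auto

lemma madden_frame_sup:
  assumes "\<And>K. K \<in> \<K> \<Longrightarrow> W_ideal G K"
  shows "\<Squnion>\<^bsub>madden_frame G\<^esub> \<K> = gen (\<Union>\<K>)"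
proof -
  interpret partial_order "madden_frame G" by (rule partial_order_madden_frame)
  have "\<Union>\<K> \<subseteq> carrier G" using assms by (meson Sup_least W_ideal.subgroup subgroup.subset)
  then have "least (madden_frame G) (gen (\<Union>\<K>)) (Upper (madden_frame G) \<K>)"
    using assms gen_superset[of "\<Union>\<K>"]
    by (intro least_UpperI) (auto simp: W_ideal_gen gen_subset_iff Upper_def)
  then show ?thesis unfolding sup_def by (metis someI least_unique)
qed

lemma madden_frame_meet:
  assumes "W_ideal G K" "W_ideal G M"
  shows "K \<sqinter>\<^bsub>madden_frame G\<^esub> M = K \<inter> M"
proof -
  interpret partial_order "madden_frame G" by (rule partial_order_madden_frame)
  have "W_ideal G (K \<inter> M)" using assms by (rule W_ideal_Int)
  then show ?thesis using assms by (intro meet_eqI) (auto simp: greatest_def Lower_def)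
qed

lemma madden_frame_top: "\<top>\<^bsub>madden_frame G\<^esub> = carrier G"
proof -
  interpret partial_order "madden_frame G" by (rule partial_order_madden_frame)
  have "greatest (madden_frame G) (carrier G) (carrier (madden_frame G))"
    using W_ideal_carrier by (auto simp: greatest_def dest: W_ideal.subgroup subgroup.mem_carrier)
  then show ?thesis unfolding top_def by (metis someI greatest_unique)
qed

section \<open>Rays and bands\<close>

text \<open>Additively, \<open>(q g - p)^+\<close>, whose cozero set is
  \<open>g > p/q\<close>.\<close>

definition ray :: "'a \<Rightarrow> int \<Rightarrow> int \<Rightarrow> 'a" where
  "ray g p q = pos (g [^] q \<otimes> inv (\<u> [^] p))"

text \<open>Additively, \<open>(q g - p)\<^sup>+ \<and> (r - q g)\<^sup>+\<close>, whose cozero set is \<open>p/q < g < r/q\<close>.\<close>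
definition band :: "'a \<Rightarrow> int \<Rightarrow> int \<Rightarrow> int \<Rightarrow> 'a" where
  "band g p q r = ray g p q \<^bold>\<sqinter> ray (inv g) (- r) q"

lemma ray_closed [simp, intro]: "g \<in> carrier G \<Longrightarrow> ray g p q \<in> carrier G"
  by (simp add: ray_def)

lemma one_le_ray [simp, intro]: "g \<in> carrier G \<Longrightarrow> \<one> \<preceq> ray g p q"
  by (simp add: ray_def)

lemma band_closed [simp, intro]: "g \<in> carrier G \<Longrightarrow> band g p q r \<in> carrier G"
  by (simp add: band_def)

lemma one_le_band [simp, intro]: "g \<in> carrier G \<Longrightarrow> \<one> \<preceq> band g p q r"
  by (simp add: band_def one_le_meet)

lemma unit_pow_mono: "p \<le> p' \<Longrightarrow> \<u> [^] p \<preceq> \<u> [^] (p'::int)"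
proof -
  assume "p \<le> p'"
  then obtain n where p': "p' = p + int n" using zle_iff_zadd by blast
  show ?thesis using one_le_pow[of \<u> n] by (simp add: p' int_pow_mult int_pow_int le_mult)
qed

lemma ray_antimono: "g \<in> carrier G \<Longrightarrow> p \<le> p' \<Longrightarrow> ray g p' q \<preceq> ray g p q"
  unfolding ray_def by (intro pos_mono mult_mono inv_antimono unit_pow_mono) auto

text \<open>Scaling numerator and denominator together keeps the endpoint; this is how common
  denominators are produced.\<close>

lemma ray_pow: "g \<in> carrier G \<Longrightarrow> ray g p q [^] (n::nat) = ray g (p * int n) (q * int n)"
  by (simp add: ray_def nat_pow_distrib nat_pow_inv int_pow_int flip: pos_pow int_pow_pow)

lemma band_pow: "g \<in> carrier G \<Longrightarrow> band g p q r [^] (n::nat) = band g (p * int n) (q * int n) (r * int n)"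
  by (simp add: band_def meet_pow ray_pow)

lemma neg_ray: "g \<in> carrier G \<Longrightarrow> ray (inv g) (- r) q = pos (\<u> [^] r \<otimes> inv (g [^] q))"
  by (simp add: ray_def int_pow_inv int_pow_neg m_comm)

lemma ray_disjoint: "g \<in> carrier G \<Longrightarrow> ray g p q \<^bold>\<sqinter> ray (inv g) (- p) q = \<one>"
  using pos_meet_neg[of "g [^] q \<otimes> inv (\<u> [^] p)"]
  by (simp add: neg_ray ray_def[of g] inv_mult_group)

lemma band_eq_one: "g \<in> carrier G \<Longrightarrow> r \<le> p \<Longrightarrow> band g p q r = \<one>"
  unfolding band_def
  by (rule disjoint_mono[of _ "ray g p q" _ "ray (inv g) (- p) q"])
    (auto simp: ray_disjoint intro: ray_antimono)

lemma band_inv: "g \<in> carrier G \<Longrightarrow> band (inv g) p q r = band g (- r) q (- p)"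
  by (simp add: band_def meet_commute)

text \<open>Moving the endpoint inwards by \<open>1/q\<close> costs at most one unit;
  \<open>band_shrink\<close> relies on this.\<close>

lemma ray_le_shift: "g \<in> carrier G \<Longrightarrow> ray g p q \<preceq> ray g (p + 1) q \<otimes> \<u>"
proof -
  assume [simp]: "g \<in> carrier G"
  have "g [^] q \<otimes> inv (\<u> [^] p) = (g [^] q \<otimes> inv (\<u> [^] (p + 1))) \<otimes> \<u>"
    by (simp add: int_pow_mult inv_mult_group m_assoc)
      (simp add: m_comm[of "inv \<u>"] m_assoc)
  also have "\<dots> \<preceq> ray g (p + 1) q \<otimes> \<u>" 
    unfolding ray_def by (intro mult_mono pos_ge) auto
  finally show ?thesis
    unfolding ray_def[of g p] by (rule pos_least) (simp add: one_le_mult)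
qed

text \<open>The rays \<open>g > p/q\<close> and \<open>g < r/q\<close> cover everything:
  \<open>(q g - p) + (r - q g) = r - p\<close>, which is at least 1 for integers
  \<open>p < r\<close>.\<close>

lemma unit_le_rays: "g \<in> carrier G \<Longrightarrow> p < r \<Longrightarrow> \<u> \<preceq> ray g p q \<otimes> ray (inv g) (- r) q"
proof -
  assume [simp]: "g \<in> carrier G" and "p < r"
  have "\<u> \<preceq> \<u> [^] (r - p)" using unit_pow_mono[of 1 "r - p"] \<open>p < r\<close> by simp
  also have "\<u> [^] (r - p) = (g [^] q \<otimes> inv (\<u> [^] p)) \<otimes> (\<u> [^] r \<otimes> inv (g [^] q))"
    by (simp add: int_pow_diff m_ac, simp add: m_lcomm[of "g [^] q"]) (simp flip: m_assoc)
  also have "\<dots> \<preceq> ray g p q \<otimes> ray (inv g) (- r) q"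
    unfolding neg_ray[OF \<open>g \<in> carrier G\<close>] unfolding ray_def by (intro mult_mono pos_ge) auto
  finally show ?thesis .
qed

text \<open>Powers bring both rays to the denominator \<open>q q'\<close>, where the order of the
  endpoints is that of the numerators.\<close>

lemma ray_le_pow:
  assumes [simp]: "g \<in> carrier G" and q: "0 < q" "0 < q'" and le: "p' * q \<le> p * q'"
  shows "ray g p q \<preceq> ray g p' q' [^] nat q"
proof -
  have "ray g p q \<preceq> ray g p q [^] nat q'" using q by (intro le_pow) auto
  also have "\<dots> \<preceq> ray g p' q' [^] nat q"
    using q le by (simp add: ray_pow mult.commute[of q'] ray_antimono del: pow_nat)
  finally show ?thesis .
qed

lemma band_le_pow:
  assumes [simp]: "g \<in> carrier G" and q: "0 < q" "0 < q'" and le: "p' * q \<le> p * q'"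
    "r * q' \<le> r' * q"
  shows "band g p q r \<preceq> band g p' q' r' [^] nat q"
  unfolding band_def using assms by (subst meet_pow)
    (auto intro!: meet_mono ray_le_pow simp del: pow_nat)

end

section \<open>Bands modulo an ideal: exhaustion, gluing and compactness\<close>

context W_ideal
begin

text \<open>When \<open>y\<close> is represented by an extended real function, it is finite on a dense set.\<close>
lemma truncation_dense:
  assumes x: "\<one> \<preceq> x" and y [simp]: "y \<in> carrier G"
    and K: "\<And>n::nat. x \<^bold>\<sqinter> pos (\<u> [^] n \<otimes> inv y) \<in> K"
  shows "x \<in> K"
proof -
  have [simp]: "x \<in> carrier G" using x by (auto dest: leq_closed)
  let ?w = "x \<^bold>\<sqinter> \<u>"
  have w: "\<one> \<preceq> ?w" using x by (simp add: one_le_meet)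
  \<comment> \<open>Additively, \<open>n w \<le> (n u - y)^+ + y^+\<close> because
    \<open>w \<le> u\<close>, so \<open>(n w - y^+)^+\<close> lies below the meet of
    \<open>n w\<close> with \<open>(n u - y)^+\<close>, which is in \<open>K\<close>.
    Archimedeanness then puts \<open>w\<close> in \<open>K\<close>, and weakness of the unit puts
    \<open>x\<close> there.\<close>
  have "pos (?w [^] n \<otimes> inv (pos y)) \<in> K" for n :: nat
  proof -
    let ?t = "pos (\<u> [^] n \<otimes> inv y)"
    have "?w \<^bold>\<sqinter> ?t \<in> K"
      by (rule convex[OF K[of n]]) (auto intro!: one_le_meet meet_mono w)
    then have "?t \<^bold>\<sqinter> ?w [^] n \<in> K" using w by (intro meet_pow_in) (auto simp: meet_commute)
    then have k: "?w [^] n \<^bold>\<sqinter> ?t \<in> K" by (simp add: meet_commute)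
    have "\<u> [^] n = (\<u> [^] n \<otimes> inv y) \<otimes> y" by (simp add: m_assoc)
    also have "\<dots> \<preceq> ?t \<otimes> pos y" by (intro mult_mono pos_ge) auto
    finally have "?w [^] n \<preceq> ?t \<otimes> pos y" using pow_mono[of ?w \<u> n] by (auto intro: leq_trans)
    then have "?w [^] n \<preceq> ?w [^] n \<^bold>\<sqinter> (?t \<otimes> pos y)" by (intro meet_greatest) auto
    also have "\<dots> \<preceq> (?w [^] n \<^bold>\<sqinter> ?t) \<otimes> (?w [^] n \<^bold>\<sqinter> pos y)"
      using w by (intro meet_mult_le one_le_pow) auto
    also have "\<dots> \<preceq> (?w [^] n \<^bold>\<sqinter> ?t) \<otimes> pos y" by (intro mult_mono) auto
    finally have "?w [^] n \<otimes> inv (pos y) \<preceq> ?w [^] n \<^bold>\<sqinter> ?t"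
      using mult_right_mono[of _ "(?w [^] n \<^bold>\<sqinter> ?t) \<otimes> pos y" "inv (pos y)"] by (simp add: m_assoc)
    then have "pos (?w [^] n \<otimes> inv (pos y)) \<preceq> ?w [^] n \<^bold>\<sqinter> ?t"
      using w by (intro pos_least) (auto intro: one_le_meet one_le_pow)
    then show ?thesis by (rule convex[OF k, rotated]) simp
  qed
  then have "?w \<in> K" by (rule arch_quot[OF w, rotated]) simp
  then show "x \<in> K" by (rule weak_quot[OF x])
qed

text \<open>For natural \<open>r\<close> these rays are the truncations of
  \<open>truncation_dense\<close> at \<open>y = g [^] q\<close>, so \<open>x\<close> is recovered
  from its parts where \<open>q g < r\<close>.\<close>

lemma ray_exhaust:
  assumes "\<one> \<preceq> x" "g \<in> carrier G" "\<And>r. x \<^bold>\<sqinter> ray (inv g) (- r) q \<in> K"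
  shows "x \<in> K"
  using assms(3)[of "int _"] assms(1,2)
  by (intro truncation_dense[of x "g [^] q"]) (simp_all add: neg_ray int_pow_int)

lemma ray_in:
  assumes "g \<in> carrier G" "0 < q" "0 < q'" "p' * q \<le> p * q'" "ray g p' q' \<in> K"
  shows "ray g p q \<in> K"
  using ray_le_pow[OF assms(1-4)] by (rule convex[rotated 2])
    (use assms in \<open>auto intro: pow_closed_K simp del: pow_nat\<close>)

lemma band_in:
  assumes "g \<in> carrier G" "0 < q" "0 < q'" "p' * q \<le> p * q'" "r * q' \<le> r' * q" "band g p' q' r' \<in> K"
  shows "band g p q r \<in> K"
  using band_le_pow[OF assms(1-5)] by (rule convex[rotated 2])
    (use assms in \<open>auto intro: pow_closed_K simp del: pow_nat\<close>)

text \<open>As the intervals overlap, the unit lies below \<open>?a \<otimes> ?b\<close>. The glued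
  band meets \<open>?a\<close> inside the second band and \<open>?b\<close> inside the first, so its
  truncation by the unit is in \<open>K\<close>, and \<open>weak_quot\<close> removes the
  truncation.\<close>

lemma band_overlap:
  assumes g [simp]: "g \<in> carrier G" and q: "0 < q" "0 < q'"
    and K: "band g p q r \<in> K" "band g p' q' r' \<in> K" and overlap: "p' * q < r * q'"
  shows "band g (p * q') (q * q') (r' * q) \<in> K"
proof -
  define Q where "Q = q * q'"
  let ?x = "band g (p * q') Q (r' * q)"
  let ?a = "ray g (p' * q) Q" and ?b = "ray (inv g) (- (r * q')) Q"
  have "0 < Q" using q by (simp add: Q_def)
  have 1: "band g (p * q') Q (r * q') \<in> K"
    by (rule band_in[OF g \<open>0 < Q\<close> q(1) _ _ K(1)]) (simp_all add: Q_def)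
  have 2: "band g (p' * q) Q (r' * q) \<in> K"
    by (rule band_in[OF g \<open>0 < Q\<close> q(2) _ _ K(2)]) (simp_all add: Q_def)
  have "?x \<^bold>\<sqinter> \<u> \<preceq> ?x \<^bold>\<sqinter> (?a \<otimes> ?b)"
    using overlap by (intro meet_mono unit_le_rays) auto
  also have "\<dots> \<preceq> (?x \<^bold>\<sqinter> ?a) \<otimes> (?x \<^bold>\<sqinter> ?b)" by (intro meet_mult_le) auto
  finally have le: "?x \<^bold>\<sqinter> \<u> \<preceq> (?x \<^bold>\<sqinter> ?a) \<otimes> (?x \<^bold>\<sqinter> ?b)" .
  have "?x \<^bold>\<sqinter> ?a \<preceq> ray (inv g) (- (r' * q)) Q \<^bold>\<sqinter> ?a"
    by (intro meet_mono) (auto simp: band_def)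
  also have "\<dots> = band g (p' * q) Q (r' * q)" by (simp add: band_def meet_commute)
  finally have a: "?x \<^bold>\<sqinter> ?a \<in> K" by (rule convex[OF 2, rotated]) (simp add: one_le_meet)
  have "?x \<^bold>\<sqinter> ?b \<preceq> band g (p * q') Q (r * q')"
    unfolding band_def[of _ _ _ "r * q'"] by (intro meet_mono) (auto simp: band_def)
  then have b: "?x \<^bold>\<sqinter> ?b \<in> K" by (rule convex[OF 1, rotated]) (simp add: one_le_meet)
  have "?x \<^bold>\<sqinter> \<u> \<in> K" by (rule convex[OF _ _ le]) (auto intro: a b one_le_meet)
  then show ?thesis using weak_quot[of ?x] by (simp add: Q_def)
qed

text \<open>The \<open>n\<close>-th power of the band exceeds the band with endpoints moved inwards
  by \<open>1/(q n)\<close> by at most one unit, for every \<open>n\<close>;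
  \<open>arch_quot\<close> with bound \<open>\<u>\<close> applies.\<close>

lemma band_shrink:
  assumes g [simp]: "g \<in> carrier G"
    and K: "\<And>n. 0 < n \<Longrightarrow> band g (p * n + 1) (q * n) (r * n - 1) \<in> K"
  shows "band g p q r \<in> K"
proof (rule arch_quot)
  fix n :: nat
  let ?x = "band g p q r"
  show "pos (?x [^] n \<otimes> inv \<u>) \<in> K"
  proof (cases "n = 0")
    \<comment> \<open>For \<open>n = 0\<close> the element is the positive part of the negated unit,
      which is trivial.\<close>
    case True
    then show ?thesis using inv_antimono[of \<one> \<u>] pos_eq_one_iff[of "inv \<u>"] by simp
  next
    case False
    let ?y = "band g (p * int n + 1) (q * int n) (r * int n - 1)"
    have "?x [^] n \<preceq> (ray g (p * int n + 1) (q * int n) \<otimes> \<u>) \<^bold>\<sqinter>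
        (ray (inv g) (- (r * int n) + 1) (q * int n) \<otimes> \<u>)"
      unfolding band_pow[OF g] unfolding band_def by (intro meet_mono ray_le_shift) auto
    also have "\<dots> = ?y \<otimes> \<u>" by (simp add: band_def meet_mult)
    finally have "?x [^] n \<otimes> inv \<u> \<preceq> ?y"
      using mult_right_mono[of _ "?y \<otimes> \<u>" "inv \<u>"] by (simp add: m_assoc)
    then have "pos (?x [^] n \<otimes> inv \<u>) \<preceq> ?y" by (intro pos_least) auto
    then show ?thesis using K[of "int n"] False by (elim convex[rotated 2]) auto
  qed
qed auto

text \<open>Compact subintervals are treated by bisection (\<open>Bolzano\<close>), with
  \<open>band_overlap\<close> joining adjacent pieces. The closed intervals whose ends are moved
  inwards by \<open>1/(q n)\<close> are of this kind, and \<open>band_shrink\<close> recovers the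
  open one.\<close>

lemma band_cover:
  assumes g: "g \<in> carrier G" and q: "0 < q"
    and cover: "\<And>x::real. of_int p / of_int q < x \<Longrightarrow> x < of_int r / of_int q \<Longrightarrow>
      \<exists>p' q' r'. 0 < q' \<and> of_int p' / of_int q' < x \<and> x < of_int r' / of_int q' \<and> band g p' q' r' \<in> K"
  shows "band g p q r \<in> K"
proof -
  \<comment> \<open>\<open>P s t\<close> says that some band in \<open>K\<close> belongs to an
    interval with \<open>s\<close> and \<open>t\<close> strictly inside. The strictness provides the
    overlap needed for gluing.\<close>
  define P where "P s t \<longleftrightarrow> (\<exists>p q r. 0 < q \<and> of_int p / of_int q < s \<and> t < of_int r / of_int q \<and>
    band g p q r \<in> K)" for s t :: real
  have P: "P s t" if "of_int p / of_int q < s" "s \<le> t" "t < of_int r / of_int q" for s t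
    using \<open>s \<le> t\<close>
  proof (induction rule: Bolzano)
    case (trans a b c)
    from \<open>P a b\<close> obtain p q r where 1: "0 < q" "of_int p / of_int q < a" "b < of_int r / of_int q"
      "band g p q r \<in> K" by (auto simp: P_def)
    from \<open>P b c\<close> obtain p' q' r' where 2: "0 < q'" "of_int p' / of_int q' < b"
      "c < of_int r' / of_int q'"
      "band g p' q' r' \<in> K" by (auto simp: P_def)
    \<comment> \<open>Both intervals contain the common endpoint \<open>b\<close>, so they
      overlap.\<close>
    have "of_int p' / of_int q' < (of_int r / of_int q :: real)" using 1 2 by linarith
    then have "real_of_int (p' * q) < real_of_int (r * q')" using 1 2 by (simp add: field_simps)
    then have "p' * q < r * q'" by linarith
    with 1 2 have "band g (p * q') (q * q') (r' * q) \<in> K" by (intro band_overlap g)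
    moreover have "of_int (p * q') / of_int (q * q') = (of_int p / of_int q :: real)"
      "of_int (r' * q) / of_int (q * q') = (of_int r' / of_int q' :: real)" using 1 2 by simp_all
    ultimately show ?case using 1 2 unfolding P_def
      by (intro exI[of _ "p * q'"] exI[of _ "q * q'"] exI[of _ "r' * q"]) auto
  next
    case (local x)
    then have "of_int p / of_int q < x" "x < of_int r / of_int q" using that by linarith+
    from cover[OF this] obtain p' q' r' where 1: "0 < q'" "of_int p' / of_int q' < x"
      "x < of_int r' / of_int q'" "band g p' q' r' \<in> K" by blast
    show ?case
    \<comment> \<open>An interval around \<open>x\<close> that is shorter than the distance from
      \<open>x\<close> to either end fits strictly inside.\<close>
    proof (intro exI[of _ "min (x - of_int p' / of_int q') (of_int r' / of_int q' - x)"] conjI allI impI)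
      fix a b assume "a \<le> x \<and> x \<le> b \<and> b - a < min (x - of_int p' / of_int q') (of_int r' / of_int q' - x)"
      then have "of_int p' / of_int q' < a" "b < of_int r' / of_int q'" by linarith+
      with 1 show "P a b" unfolding P_def by blast
    qed (use 1 in auto)
  qed
  show ?thesis
  proof (rule band_shrink[OF g])
    fix n :: int assume n: "0 < n"
    show "band g (p * n + 1) (q * n) (r * n - 1) \<in> K"
    proof (cases "p * n + 1 \<le> r * n - 1")
      \<comment> \<open>The shrunk endpoints are out of order, so the band is trivial.\<close>
      case False
      then show ?thesis using g by (simp add: band_eq_one)
    next
      case True
      let ?s = "of_int (p * n + 1) / of_int (q * n) :: real"
        and ?t = "of_int (r * n - 1) / of_int (q * n) :: real"
      have nq: "0 < real_of_int q" "0 < real_of_int n" using q n by auto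
      have "P ?s ?t"
      proof (rule P)
        show "?s \<le> ?t" using True nq by (intro divide_right_mono)
          (auto simp del: of_int_add of_int_diff)
      qed (use nq in \<open>simp_all add: field_simps\<close>)
      then obtain p' q' r' where 1: "0 < q'" "of_int p' / of_int q' < ?s"
        "?t < of_int r' / of_int q'"
        "band g p' q' r' \<in> K" unfolding P_def by blast
      have nq': "0 < real_of_int (q * n)" "0 < real_of_int q'" using nq 1 by auto
      have "real_of_int (p' * (q * n)) < of_int ((p * n + 1) * q')"
        using 1(2) nq' unfolding of_int_mult
          by (simp add: divide_less_eq less_divide_eq mult.commute)
      moreover have "real_of_int ((r * n - 1) * q') < of_int (r' * (q * n))"
        using 1(3) nq' unfolding of_int_mult
          by (simp add: divide_less_eq less_divide_eq mult.commute)
      ultimately have "p' * (q * n) \<le> (p * n + 1) * q'"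
        "(r * n - 1) * q' \<le> r' * (q * n)" by linarith+
      then show ?thesis using q n 1 by (intro band_in[OF g _ 1(1) _ _ 1(4)]) auto
    qed
  qed
qed

end

lemma (in W_morphism) map_ray: "g \<in> carrier G \<Longrightarrow> \<theta> (dom.ray g p q) = cod.ray (\<theta> g) p q"
  by (simp add: dom.ray_def cod.ray_def map_pos hom_int_pow unit)

section \<open>The Madden representation\<close>

lemma rational_interval_in_open:
  fixes x :: real
  assumes "open U" "x \<in> U"
  obtains p q r where "0 < q" "of_int p / of_int q < x" "x < of_int r / of_int q"
    "{of_int p / of_int q <..< of_int r / of_int q} \<subseteq> U"
proof -
  obtain d where d: "0 < d" "\<And>y. dist y x < d \<Longrightarrow> y \<in> U" using assms by (auto simp: open_dist)
  obtain n where "inverse (real (Suc n)) < d" using reals_Archimedean[OF \<open>0 < d\<close>] by auto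
  then have n: "1 < d * real (Suc n)" by (simp add: field_simps)
  define q where "q = int (Suc n)"
  \<comment> \<open>Rounding outwards to multiples of \<open>1/q\<close>: the offsets by one keep
    \<open>x\<close> strictly inside even if it is itself such a multiple, and both ends stay within
    \<open>1/q < d\<close> of \<open>x\<close>.\<close>
  define p where "p = \<lceil>x * of_int q\<rceil> - 1"
  define r where "r = \<lfloor>x * of_int q\<rfloor> + 1"
  have q: "0 < real_of_int q" "1 < d * real_of_int q" using n by (auto simp: q_def)
  have pr: "of_int p < x * of_int q" "x * of_int q - 1 \<le> of_int p"
    "x * of_int q < of_int r" "of_int r \<le> x * of_int q + 1"
    unfolding p_def r_def by linarith+
  have "y \<in> U" if "y \<in> {of_int p / of_int q <..< of_int r / of_int q}" for y
  proof (rule d(2))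
    have "of_int p < y * of_int q" "y * of_int q < of_int r"
      using that q by (auto simp: divide_less_eq less_divide_eq)
    then have "\<bar>y * of_int q - x * of_int q\<bar> < d * of_int q" using pr q by linarith
    also have "\<bar>y * of_int q - x * of_int q\<bar> = \<bar>y - x\<bar> * of_int q"
      using q by (simp add: abs_mult flip: left_diff_distrib)
    finally show "dist y x < d" using q by (simp add: dist_real_def)
  qed
  then show ?thesis using pr q by (intro that[of q p r]) (auto simp: divide_less_eq less_divide_eq)
qed

section \<open>The spectral map as a frame map\<close>

context W_object
begin

definition spectral :: "'a \<Rightarrow> real set \<Rightarrow> 'a set" where
  "spectral g U = gen {band g p q r | p q r. 0 < q \<and> {of_int p / of_int q <..< of_int r / of_int q} \<subseteq> U}"

lemma W_ideal_spectral [simp]: "g \<in> carrier G \<Longrightarrow> W_ideal G (spectral g U)"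
  unfolding spectral_def by (intro W_ideal_gen) auto

lemma spectral_subset_iff:
  "W_ideal G K \<Longrightarrow> spectral g U \<subseteq> K \<longleftrightarrow>
    (\<forall>p q r. 0 < q \<longrightarrow> {of_int p / of_int q <..< of_int r / of_int q} \<subseteq> U \<longrightarrow> band g p q r \<in> K)"
  unfolding spectral_def by (subst gen_subset_iff) blast+

lemma band_in_spectral:
  "0 < q \<Longrightarrow> {of_int p / of_int q <..< of_int r / of_int q} \<subseteq> U \<Longrightarrow> band g p q r \<in> spectral g U"
  unfolding spectral_def by (rule subsetD[OF gen_superset]) blast

lemma spectral_mono: "g \<in> carrier G \<Longrightarrow> U \<subseteq> V \<Longrightarrow> spectral g U \<subseteq> spectral g V"
  by (subst spectral_subset_iff) (auto intro!: band_in_spectral)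

text \<open>Each point of an interval inside the union has a rational neighbourhood inside one
  member, whose band is a generator; \<open>band_cover\<close> assembles these.\<close>

lemma spectral_Union:
  assumes g: "g \<in> carrier G" and \<U>: "\<And>U. U \<in> \<U> \<Longrightarrow> open U"
  shows "spectral g (\<Union>\<U>) = gen (\<Union>(spectral g ` \<U>))"
proof
  have sub: "\<Union>(spectral g ` \<U>) \<subseteq> carrier G"
    using g W_ideal.subgroup[OF W_ideal_spectral] subgroup.subset by blast
  interpret K: W_ideal G "gen (\<Union>(spectral g ` \<U>))" using sub by (rule W_ideal_gen)
  show "spectral g (\<Union>\<U>) \<subseteq> gen (\<Union>(spectral g ` \<U>))"
  proof (subst spectral_subset_iff[OF K.W_ideal_axioms], intro allI impI)
    fix p q r :: int assume q: "0 < q"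
      and sub: "{of_int p / of_int q <..< of_int r / of_int q} \<subseteq> \<Union>\<U>"
    show "band g p q r \<in> gen (\<Union>(spectral g ` \<U>))"
    proof (rule K.band_cover[OF g q])
      fix x :: real assume "of_int p / of_int q < x" "x < of_int r / of_int q"
      then obtain U where U: "U \<in> \<U>" "x \<in> U" using sub by auto
      then obtain p' q' r' where 1: "0 < q'" "of_int p' / of_int q' < x" "x < of_int r' / of_int q'"
        "{of_int p' / of_int q' <..< of_int r' / of_int q'} \<subseteq> U"
        using rational_interval_in_open \<U> by metis
      then have "band g p' q' r' \<in> spectral g U" by (intro band_in_spectral)
      then have "band g p' q' r' \<in> gen (\<Union>(spectral g ` \<U>))"
        using gen_superset[of "\<Union>(spectral g ` \<U>)"] U by blast
      with 1 show "\<exists>p' q' r'. 0 < q' \<and> of_int p' / of_int q' < x \<and> x < of_int r' / of_int q' \<and>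
        band g p' q' r' \<in> gen (\<Union>(spectral g ` \<U>))" by blast
    qed
  qed
  show "gen (\<Union>(spectral g ` \<U>)) \<subseteq> spectral g (\<Union>\<U>)"
    using g spectral_mono[OF g, of _ "\<Union>\<U>"] by (intro gen_least) auto
qed

lemma spectral_Int:
  assumes g [simp]: "g \<in> carrier G"
  shows "spectral g (U \<inter> V) = spectral g U \<inter> spectral g V"
proof
  interpret K: W_ideal G "spectral g (U \<inter> V)" by simp
  show "spectral g U \<inter> spectral g V \<subseteq> spectral g (U \<inter> V)"
    unfolding spectral_def[of g U] spectral_def[of g V]
  proof (rule gen_Int_subset[OF K.W_ideal_axioms], safe)
    fix p q r p' q' r' :: int assume q: "0 < q" "0 < q'"
      and U: "{of_int p / of_int q <..< of_int r / of_int q} \<subseteq> U"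
      and V: "{of_int p' / of_int q' <..< of_int r' / of_int q'} \<subseteq> V"
    \<comment> \<open>Over the common denominator \<open>Q\<close> the intersection of the two
      intervals has the larger left and the smaller right numerator.\<close>
    define P where "P = max (p * q') (p' * q)"
    define R where "R = min (r * q') (r' * q)"
    define Q where "Q = q * q'"
    have Q: "0 < Q" using q by (simp add: Q_def)
    have eq: "real_of_int p / of_int q = of_int (p * q') / of_int Q"
      "real_of_int r / of_int q = of_int (r * q') / of_int Q"
      "real_of_int p' / of_int q' = of_int (p' * q) / of_int Q"
        "real_of_int r' / of_int q' = of_int (r' * q) / of_int Q"
      using q by (simp_all add: Q_def)
    have "of_int (p * q') / of_int Q \<le> real_of_int P / of_int Q"
      "of_int (p' * q) / of_int Q \<le> real_of_int P / of_int Q"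
      "real_of_int R / of_int Q \<le> of_int (r * q') / of_int Q"
        "real_of_int R / of_int Q \<le> of_int (r' * q) / of_int Q"
      using Q by (auto intro!: divide_right_mono simp: P_def R_def simp del: of_int_mult)
    then have "{of_int P / of_int Q <..< real_of_int R / of_int Q} \<subseteq> U \<inter> V"
      using U V unfolding eq by fastforce
    then have K: "band g P Q R \<in> spectral g (U \<inter> V)" using Q by (intro band_in_spectral)
    \<comment> \<open>A positive element lies below its positive powers, and by
      \<open>band_pow\<close> a power brings the band to the denominator \<open>Q\<close>.\<close>
    have le: "band g p q r \<preceq> band g (p * q') Q (r * q') "
      using le_pow[of "band g p q r" "nat q'"] q by (simp add: band_pow Q_def del: pow_nat)
    have le': "band g p' q' r' \<preceq> band g (p' * q) Q (r' * q)"
      using le_pow[of "band g p' q' r'" "nat q"] q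
        by (simp add: band_pow Q_def mult.commute del: pow_nat)
    let ?m = "band g p q r \<^bold>\<sqinter> band g p' q' r'"
    have m: "?m \<preceq> band g (p * q') Q (r * q')" "?m \<preceq> band g (p' * q) Q (r' * q)"
      using le le' meet_left meet_right by (meson band_closed g leq_trans)+
    then have "?m \<preceq> ray g (p * q') Q" "?m \<preceq> ray (inv g) (- (r * q')) Q"
      "?m \<preceq> ray g (p' * q) Q" "?m \<preceq> ray (inv g) (- (r' * q)) Q"
      unfolding band_def[of _ _ Q]
        by (meson meet_left meet_right ray_closed g inv_closed leq_trans)+
    then have "?m \<preceq> band g P Q R"
      unfolding band_def[of _ _ Q] by (intro meet_greatest) (auto simp: P_def R_def max_def min_def)
    then show "?m \<in> spectral g (U \<inter> V)" by (rule K.convex[OF K, rotated]) (simp add: one_le_meet)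
  qed auto
qed (auto dest: subsetD[OF spectral_mono[OF g], rotated])

text \<open>A nonempty interval inside the upper ray starts at or beyond \<open>p/q\<close>, so
  \<open>ray_in\<close> controls its band. Conversely the meets of \<open>ray g p q\<close> with the
  lower rays are bands, and \<open>ray_exhaust\<close> recovers the ray from them.\<close>

lemma spectral_ray:
  assumes g [simp]: "g \<in> carrier G" and q: "0 < q"
  shows "spectral g {of_int p / of_int q <..} = gen {ray g p q}"
proof
  interpret K: W_ideal G "gen {ray g p q}" by (rule W_ideal_gen) simp
  have K: "ray g p q \<in> gen {ray g p q}" using gen_superset[of "{ray g p q}"] by blast
  show "spectral g {of_int p / of_int q <..} \<subseteq> gen {ray g p q}"
  proof (subst spectral_subset_iff[OF K.W_ideal_axioms], intro allI impI)
    fix p' q' r' :: int assume q': "0 < q'"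
      and sub: "{of_int p' / of_int q' <..< of_int r' / of_int q'} \<subseteq> {real_of_int p / of_int q <..}"
    show "band g p' q' r' \<in> gen {ray g p q}"
    proof (cases "r' \<le> p'")
      case False
      then have "real_of_int p' / of_int q' < of_int r' / of_int q'" using q'
        by (simp add: divide_strict_right_mono)
      have "real_of_int p / of_int q \<le> of_int p' / of_int q'"
      proof (rule ccontr)
        assume "\<not> ?thesis"
        then obtain y where "real_of_int p' / of_int q' < y"
          "y < min (of_int r' / of_int q') (of_int p / of_int q)"
          using dense[of "real_of_int p' / of_int q'"
            "min (of_int r' / of_int q') (of_int p / of_int q)"]
            \<open>real_of_int p' / of_int q' < of_int r' / of_int q'\<close> by auto
        then show False using sub by auto
      qed
      then have "real_of_int (p * q') \<le> of_int (p' * q)" using q q' by (simp add: field_simps)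
      then have "p * q' \<le> p' * q" by linarith
      then have "ray g p' q' \<in> gen {ray g p q}" using q q' K
        by (intro K.ray_in[of g q' q p p']) auto
      then show ?thesis by (rule K.convex) (auto simp: band_def one_le_meet)
    qed (simp add: band_eq_one)
  qed
  interpret S: W_ideal G "spectral g {of_int p / of_int q <..}" by simp
  have "ray g p q \<in> spectral g {of_int p / of_int q <..}"
    by (rule S.ray_exhaust[of _ g q]) (use q in \<open>auto intro!: band_in_spectral simp flip: band_def\<close>)
  then show "gen {ray g p q} \<subseteq> spectral g {of_int p / of_int q <..}"
    by (intro gen_least) auto
qed

text \<open>The kernel contains all rays \<open>g > p\<close>. Exhausting the unit by them, with
  \<open>inv g\<close> in place of \<open>g\<close>, puts the unit into the kernel, and weakness of
  the unit then gives everything.\<close>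

lemma spectral_UNIV:
  assumes g [simp]: "g \<in> carrier G"
  shows "spectral g UNIV = carrier G"
proof -
  interpret K: W_ideal G "spectral g UNIV" by simp
  have "ray g p 1 \<in> spectral g UNIV" for p
  proof -
    have "ray g p 1 \<in> spectral g {of_int p / of_int 1 <..}"
      using gen_superset[of "{ray g p 1}"] by (subst spectral_ray) auto
    then show ?thesis using spectral_mono[OF g, of _ UNIV] by blast
  qed
  then have "\<u> \<^bold>\<sqinter> ray (inv (inv g)) (- r) 1 \<in> spectral g UNIV" for r
    by (rule K.convex) (auto simp: one_le_meet)
  then have u: "\<u> \<in> spectral g UNIV" by (intro K.ray_exhaust[of \<u> "inv g" 1]) auto
  have "x \<in> spectral g UNIV" if "\<one> \<preceq> x" for x
    by (rule K.weak_quot[OF that], rule K.convex[OF u])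
      (use that in \<open>auto simp: one_le_meet dest: leq_closed\<close>)
  then show ?thesis using W_ideal_subset_iff[OF W_ideal_carrier K.W_ideal_axioms] K.subset by auto
qed

lemma spectral_inv:
  assumes g [simp]: "g \<in> carrier G"
  shows "spectral (inv g) U = spectral g (uminus ` U)"
proof -
  have 1: "spectral (inv g) U \<subseteq> spectral g (uminus ` U)" if [simp]: "g \<in> carrier G" for g U
  proof (subst spectral_subset_iff, simp, intro allI impI)
    fix p q r :: int assume "0 < q" and sub: "{of_int p / of_int q <..< of_int r / of_int q} \<subseteq> U"
    have "{of_int (- r) / of_int q <..< of_int (- p) / of_int q} \<subseteq> uminus ` U"
    proof
      fix x :: real assume "x \<in> {of_int (- r) / of_int q <..< of_int (- p) / of_int q}"
      then show "x \<in> uminus ` U" using sub by (intro image_eqI[of _ _ "- x"]) auto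
    qed
    then have "band g (- r) q (- p) \<in> spectral g (uminus ` U)"
      using \<open>0 < q\<close> by (intro band_in_spectral)
    then show "band (inv g) p q r \<in> spectral g (uminus ` U)" by (simp add: band_inv)
  qed
  \<comment> \<open>The reverse inclusion is the first one at \<open>inv g\<close> and the reflected
    set.\<close>
  show ?thesis using 1[OF g, of U] 1[of "inv g" "uminus ` U"] by (simp add: image_image)
qed

lemma spectral_frame_map:
  assumes g: "g \<in> carrier G"
  shows "restrict (spectral g) {U. open U} \<in> real_frame_maps (madden_frame G)"
proof -
  have 1: "restrict (spectral g) {U. open U} (\<Union>\<U>) =
      \<Squnion>\<^bsub>madden_frame G\<^esub> (restrict (spectral g) {U. open U} ` \<U>)" if "\<forall>U\<in>\<U>. open U" for \<U>
  proof -
    have "restrict (spectral g) {U. open U} ` \<U> = spectral g ` \<U>" using that by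
      (auto simp: image_iff)
    moreover have "\<Squnion>\<^bsub>madden_frame G\<^esub> (spectral g ` \<U>) = gen (\<Union>(spectral g ` \<U>))"
      using g by (intro madden_frame_sup) auto
    ultimately show ?thesis using g that by (simp add: spectral_Union open_Union)
  qed
  then show ?thesis unfolding real_frame_maps_def
    using g by (auto simp: spectral_UNIV spectral_Int madden_frame_top madden_frame_meet)
qed

section \<open>Frame maps are determined by their upper rays\<close>

lemma real_frame_maps_ideal:
  "\<phi> \<in> real_frame_maps (madden_frame G) \<Longrightarrow> open U \<Longrightarrow> W_ideal G (\<phi> U)"
  by (auto simp: real_frame_maps_def)

lemma real_frame_maps_Int:
  "\<phi> \<in> real_frame_maps (madden_frame G) \<Longrightarrow> open U \<Longrightarrow> open V \<Longrightarrow> \<phi> (U \<inter> V) = \<phi> U \<inter> \<phi> V"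
  by (simp add: real_frame_maps_ideal flip: madden_frame_meet) (simp add: real_frame_maps_def)

lemma real_frame_maps_Union:
  assumes "\<phi> \<in> real_frame_maps (madden_frame G)" "\<And>U. U \<in> \<U> \<Longrightarrow> open U"
  shows "\<phi> (\<Union>\<U>) = gen (\<Union>(\<phi> ` \<U>))"
proof -
  have "\<phi> (\<Union>\<U>) = \<Squnion>\<^bsub>madden_frame G\<^esub> (\<phi> ` \<U>)" using assms by (simp add: real_frame_maps_def)
  also have "\<dots> = gen (\<Union>(\<phi> ` \<U>))"
    using assms by (intro madden_frame_sup) (auto intro: real_frame_maps_ideal)
  finally show ?thesis .
qed

text \<open>A frame map sends \<open>{..<s}\<close> to the join of the images of \<open>{..<t}\<close>, \<open>t < s\<close>, and each of these
  is disjoint from the image of \<open>{t<..}\<close>, which together with that of \<open>{..<s}\<close> covers.\<close>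
lemma real_frame_maps_lower_ray:
  assumes \<phi>: "\<phi> \<in> real_frame_maps (madden_frame G)" and \<psi>: "\<psi> \<in> real_frame_maps (madden_frame G)"
    and eq: "\<And>r. \<phi> {r<..} = \<psi> {r<..}"
  shows "\<phi> {..<s} \<subseteq> \<psi> {..<s}"
proof -
  note [simp] = real_frame_maps_ideal[OF \<phi>] real_frame_maps_ideal[OF \<psi>]
  note convex = W_ideal.convex[OF real_frame_maps_ideal[OF \<phi>]]
  have "\<phi> {..<t} \<subseteq> \<psi> {..<s}" if "t < s" for t
  proof (subst W_ideal_subset_iff, simp, simp, intro ballI impI)
    fix x assume x: "x \<in> \<phi> {..<t}" "\<one> \<preceq> x"
    \<comment> \<open>This residual contains the images of \<open>{t<..}\<close> and of
      \<open>{..<s}\<close>; as these cover the line, it contains \<open>x\<close>, which is its own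
      meet with \<open>x\<close>.\<close>
    let ?R = "residual (\<psi> {..<s}) x"
    have R: "W_ideal G ?R" using x by (intro W_ideal_residual) auto
    have "\<psi> {t<..} \<subseteq> ?R"
    proof (subst W_ideal_subset_iff, simp, rule R, intro ballI impI)
      fix a assume a: "a \<in> \<psi> {t<..}" "\<one> \<preceq> a"
      have c: "a \<in> carrier G" "x \<in> carrier G" using a x by (auto dest: leq_closed)
      have "a \<^bold>\<sqinter> x \<in> \<phi> {t<..}" "a \<^bold>\<sqinter> x \<in> \<phi> {..<t}"
        using a x c convex[of "{t<..}" a "a \<^bold>\<sqinter> x"] convex[of "{..<t}" x "a \<^bold>\<sqinter> x"]
        by (simp_all add: one_le_meet eq)
      then have "a \<^bold>\<sqinter> x \<in> \<phi> ({t<..} \<inter> {..<t})" by (subst real_frame_maps_Int[OF \<phi>]) auto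
      \<comment> \<open>The empty set, as the empty union, goes to the least kernel.\<close>
      also have "{t<..} \<inter> {..<t} = \<Union>{}" by auto
      also have "\<phi> (\<Union>{}) = gen {}" by (subst real_frame_maps_Union[OF \<phi>]) auto
      also have "\<dots> \<subseteq> \<psi> {..<s}" by (intro gen_least) auto
      finally show "a \<in> ?R" using a x by (subst in_residual_iff) auto
    qed
    moreover have "\<psi> {..<s} \<subseteq> ?R"
    proof (subst W_ideal_subset_iff, simp, rule R, intro ballI impI)
      fix a assume a: "a \<in> \<psi> {..<s}" "\<one> \<preceq> a"
      have "a \<^bold>\<sqinter> x \<in> \<psi> {..<s}"
        by (rule W_ideal.convex[OF _ a(1)]) (use a x in \<open>auto intro: one_le_meet dest: leq_closed\<close>)
      then show "a \<in> ?R" using a x by (subst in_residual_iff) auto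
    qed
    ultimately have "gen (\<Union>(\<psi> ` {{t<..}, {..<s}})) \<subseteq> ?R" using R by (intro gen_least) auto
    then have "\<psi> (\<Union>{{t<..}, {..<s}}) \<subseteq> ?R" by (subst real_frame_maps_Union[OF \<psi>]) auto
    also have "\<Union>{{t<..}, {..<s}} = UNIV" using \<open>t < s\<close> by auto
    also have "\<psi> UNIV = carrier G" using \<psi> by (simp add: real_frame_maps_def madden_frame_top)
    finally have "x \<in> ?R" using x by (auto dest: leq_closed)
    then have "x \<^bold>\<sqinter> x \<in> \<psi> {..<s}" using x by (subst (asm) in_residual_iff) auto
    then show "x \<in> \<psi> {..<s}" using x meet_absorb[of x x] by (auto dest: leq_closed)
  qed
  then have "gen (\<Union>(\<phi> ` (lessThan ` {..<s}))) \<subseteq> \<psi> {..<s}" by (intro gen_least) auto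
  then have "\<phi> (\<Union>(lessThan ` {..<s})) \<subseteq> \<psi> {..<s}" by (subst real_frame_maps_Union[OF \<phi>]) auto
  moreover have "\<Union>(lessThan ` {..<s}) = {..<s}" using dense by fastforce
  ultimately show ?thesis by simp
qed

text \<open>Upper rays fix the lower rays, intersections of the two fix the open intervals, and
  these form a base. Off the open sets the values agree by extensionality.\<close>

lemma real_frame_maps_eqI:
  assumes \<phi>: "\<phi> \<in> real_frame_maps (madden_frame G)" and \<psi>: "\<psi> \<in> real_frame_maps (madden_frame G)"
    and eq: "\<And>r. \<phi> {r<..} = \<psi> {r<..}"
  shows "\<phi> = \<psi>"
proof
  fix U :: "real set"
  have lower: "\<phi> {..<s} = \<psi> {..<s}" for s
    using real_frame_maps_lower_ray[OF \<phi> \<psi> eq] real_frame_maps_lower_ray[OF \<psi> \<phi> eq[symmetric]] by blast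
  show "\<phi> U = \<psi> U"
  proof (cases "open U")
    case False
    then show ?thesis using \<phi> \<psi> by (auto simp: real_frame_maps_def PiE_def extensional_def)
  next
    case True
    have interval: "\<phi> {a<..<b} = \<psi> {a<..<b}" for a b :: real
    proof -
      have "{a<..<b} = {a<..} \<inter> {..<b}" by auto
      then show ?thesis using \<phi> \<psi> eq lower by (simp add: real_frame_maps_def)
    qed
    define \<U> where "\<U> = {{a<..<b} | a b. {a<..<b} \<subseteq> U}"
    have "U = \<Union>\<U>"
    proof (safe)
      fix x assume "x \<in> U"
      with True obtain p q r :: int where "of_int p / of_int q < x" "x < of_int r / of_int q"
        "{of_int p / of_int q <..< of_int r / of_int q} \<subseteq> U" by (rule rational_interval_in_open)
      then show "x \<in> \<Union>\<U>" by (intro UnionI[of "{of_int p / of_int q <..< of_int r / of_int q}"])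
        (auto simp: \<U>_def)
    qed (auto simp: \<U>_def)
    moreover have "\<phi> ` \<U> = \<psi> ` \<U>" using interval by (auto simp: \<U>_def image_iff)
    moreover have "\<forall>V\<in>\<U>. open V" by (auto simp: \<U>_def)
    ultimately show ?thesis using \<phi> \<psi> by (simp add: real_frame_maps_def)
  qed
qed

lemma ray_kernel_eq: "ray_kernel G g p q = gen {ray g p q}"
  by (simp add: ray_kernel_def ray_def pos_def)

lemma ray_kernel_spectral:
  "g \<in> carrier G \<Longrightarrow> 0 < q \<Longrightarrow> ray_kernel G g p q = spectral g {of_int p / of_int q <..}"
  by (simp add: ray_kernel_eq spectral_ray)

lemma spectral_upper_ray:
  assumes g: "g \<in> carrier G"
  shows "spectral g {r<..} = \<Squnion>\<^bsub>madden_frame G\<^esub> {ray_kernel G g p q | p q. 0 < q \<and> r < of_int p / of_int q}"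
proof -
  let ?I = "{(p, q). 0 < q \<and> r < of_int p / of_int q} :: (int \<times> int) set"
  let ?\<U> = "(\<lambda>(p, q). {of_int p / of_int q <..} :: real set) ` ?I"
  have "x \<in> \<Union>?\<U>" if rx: "r < x" for x
  proof -
    obtain y where "y \<in> \<rat>" "r < y" "y < x" using Rats_dense_in_real[OF rx] by auto
    moreover from this obtain p q where "0 < q" "y = of_int p / of_int q"
      by (auto elim!: Rats_cases')
    ultimately show ?thesis by auto
  qed
  then have "{r<..} = \<Union>?\<U>" by (auto intro: less_trans)
  also have "spectral g \<dots> = gen (\<Union>(spectral g ` ?\<U>))" using g by (intro spectral_Union) auto
  also have "spectral g ` ?\<U> = (\<lambda>(p, q). ray_kernel G g p q) ` ?I"
    unfolding image_image using g by (intro image_cong) (auto simp: ray_kernel_spectral)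
  also have "\<dots> = {ray_kernel G g p q | p q. 0 < q \<and> r < of_int p / of_int q}" by auto
  finally show ?thesis using g by (subst madden_frame_sup) (auto simp: ray_kernel_spectral)
qed

text \<open>The spectral map satisfies both clauses by \<open>ray_kernel_spectral\<close> and
  \<open>spectral_upper_ray\<close>; uniqueness is \<open>real_frame_maps_eqI\<close>.\<close>

lemma madden_rep_eq:
  assumes g: "g \<in> carrier G"
  shows "madden_rep G g = restrict (spectral g) {U. open U}"
  unfolding madden_rep_def
proof (rule the_equality, safe)
  show "restrict (spectral g) {U. open U} \<in> real_frame_maps (madden_frame G)"
    using g by (rule spectral_frame_map)
next
  fix \<phi> assume "\<phi> \<in> real_frame_maps (madden_frame G)"
    "\<forall>r. \<phi> {r<..} = \<Squnion>\<^bsub>madden_frame G\<^esub> {ray_kernel G g p q | p q. 0 < q \<and> r < of_int p / of_int q}"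
  then show "\<phi> = restrict (spectral g) {U. open U}"
    using g by (intro real_frame_maps_eqI spectral_frame_map) (simp_all add: spectral_upper_ray)
qed (use g in \<open>simp_all add: ray_kernel_spectral spectral_upper_ray\<close>)

section \<open>Pointwise suprema and infima\<close>

lemma W_ideal_trivial: "W_ideal G {\<one>}"
proof (intro W_ideal.intro W_ideal_axioms.intro W_object_axioms)
  fix x y assume x: "\<one> \<preceq> x" "y \<in> carrier G" and le: "\<And>n::nat. pos (x [^] n \<otimes> inv y) \<in> {\<one>}"
  have c: "x \<in> carrier G" using x by (auto dest: leq_closed)
  have "x [^] n \<preceq> y" for n :: nat
    using le[of n] x c by (subst leq_iff_diff) (simp_all add: pos_eq_one_iff)
  then show "x \<in> {\<one>}" using archimedean[of x y] x c by (simp add: leq_def)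
next
  fix x assume "\<one> \<preceq> x" "x \<^bold>\<sqinter> \<u> \<in> {\<one>}"
  then show "x \<in> {\<one>}" using wunit_weak[of x] by (simp add: leq_def)
qed (auto simp: triv_subgroup pos_of_pos intro: leq_antisym)

text \<open>Where \<open>y \<ge> z + 1\<close>, an integer \<open>p\<close> with \<open>z < p < y\<close> separates \<open>z\<close> from \<open>y\<close>: starting from \<open>m < z\<close>,
  the hypothesis propagates \<open>p \<le> z\<close> to \<open>p + 1 \<le> z\<close>, which is impossible where \<open>z < r\<close>.\<close>
lemma separation_step:
  assumes x [simp]: "x \<in> carrier G" and b [simp]: "b \<in> carrier G"
    and disj: "\<And>p. ray x p q \<^bold>\<sqinter> ray (inv b) (- p) q = \<one>"
  shows "pos (x [^] q \<otimes> inv (b [^] q) \<otimes> inv \<u>) \<^bold>\<sqinter> band b m q r = \<one>"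
proof -
  let ?v = "pos (x [^] q \<otimes> inv (b [^] q) \<otimes> inv \<u>)"
  let ?d = "?v \<^bold>\<sqinter> band b m q r"
  have d: "\<one> \<preceq> ?d" by (simp add: one_le_meet)
  have dm: "?d \<preceq> ray b m q" and dr: "?d \<preceq> ray (inv b) (- r) q"
    unfolding band_def by (meson leq_trans meet_left meet_right meet_closed ray_closed pos_closed
      m_closed inv_closed unit_closed int_pow_closed x b)+
  \<comment> \<open>Disjointness from \<open>(m + k - q b)^+\<close> expresses that
    \<open>m + k \<le> q b\<close> on the cozero set of \<open>?d\<close>.\<close>
  have step: "?d \<^bold>\<sqinter> ray (inv b) (- (m + int k)) q = \<one>" for k
  proof (induction k)
    case 0
    show ?case
      using disjoint_mono[OF d dm, of "ray (inv b) (- m) q" "ray (inv b) (- m) q"]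
        by (simp add: ray_disjoint)
  next
    case (Suc k)
    define p where "p = m + int k"
    let ?t = "?d \<^bold>\<sqinter> ray (inv b) (- (p + 1)) q"
    have t: "\<one> \<preceq> ?t" using d by (simp add: one_le_meet)
    \<comment> \<open>Additively, \<open>q x - q b - 1 = (q x - (p + 1)) + (p - q b)\<close>. The
      element \<open>?t\<close> lies below the sum of the positive parts but is disjoint from both,
      from the first by \<open>disj\<close> and from the second by induction.\<close>
    have "x [^] q \<otimes> inv (b [^] q) \<otimes> inv \<u> = (x [^] q \<otimes> inv (\<u> [^] (p + 1))) \<otimes> (\<u> [^] p \<otimes> inv (b [^] q))"
      by (simp add: int_pow_mult inv_mult m_ac) (simp add: m_lcomm[of "\<u> [^] p"])
    also have "\<dots> \<preceq> ray x (p + 1) q \<otimes> ray (inv b) (- p) q"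
      unfolding neg_ray[OF b] unfolding ray_def by (intro mult_mono pos_ge) auto
    finally have "?v \<preceq> ray x (p + 1) q \<otimes> ray (inv b) (- p) q"
      by (rule pos_least) (simp add: one_le_mult)
    moreover have "?t \<preceq> ?v"
      by (meson leq_trans meet_left meet_closed band_closed ray_closed pos_closed
      m_closed inv_closed unit_closed int_pow_closed x b)
    ultimately have le: "?t \<preceq> ray x (p + 1) q \<otimes> ray (inv b) (- p) q" by (rule leq_trans[rotated])
    have "?t \<^bold>\<sqinter> ray x (p + 1) q = \<one>"
      by (rule disjoint_mono[OF t, of "ray (inv b) (- (p + 1)) q" _ "ray x (p + 1) q"])
        (use disj[of "p + 1"] in \<open>simp_all add: meet_commute\<close>)
    moreover have "?t \<^bold>\<sqinter> ray (inv b) (- p) q = \<one>"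
      by (rule disjoint_mono[OF t, of ?d _ "ray (inv b) (- p) q"])
        (use Suc in \<open>simp_all add: p_def\<close>)
    ultimately have "?t \<^bold>\<sqinter> (ray x (p + 1) q \<otimes> ray (inv b) (- p) q) = \<one>"
      by (intro disjoint_mult t) auto
    then have "?t = \<one>" using meet_absorb[OF le] by simp
    then show ?case by (simp add: p_def add_ac)
  qed
  show ?thesis
  \<comment> \<open>For \<open>r \<le> m\<close> the band is trivial; otherwise
    \<open>k = r - m\<close> makes \<open>?d\<close> disjoint from a ray lying above it.\<close>
  proof (cases "r \<le> m")
    case True
    then show ?thesis by (metis b band_eq_one d leq_antisym leq_closed(2) meet_right pos_closed
      m_closed inv_closed unit_closed int_pow_closed x band_closed)
  next
    case False
    then have "?d \<^bold>\<sqinter> ray (inv b) (- r) q = \<one>" using step[of "nat (r - m)"] by simp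
    then show ?thesis using meet_absorb[OF dr] by simp
  qed
qed

text \<open>The hypothesis says that nowhere \<open>b < p/q < x\<close>. By
  \<open>separation_step\<close> this bounds \<open>q (x - b)\<close> by the unit wherever
  \<open>b\<close> is bounded, hence everywhere by exhaustion; as \<open>q\<close> is arbitrary,
  archimedeanness finishes.\<close>

lemma leq_of_disjoint_rays:
  assumes x [simp]: "x \<in> carrier G" and b [simp]: "b \<in> carrier G"
    and disj: "\<And>p q. 0 < q \<Longrightarrow> ray x p q \<^bold>\<sqinter> ray (inv b) (- p) q = \<one>"
  shows "x \<preceq> b"
proof -
  interpret T: W_ideal G "{\<one>}" by (rule W_ideal_trivial)
  let ?z = "x \<otimes> inv b"
  have "pos ?z [^] n \<preceq> \<u>" for n :: nat
  proof (cases "n = 0")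
    case False
    define q where "q = int n"
    let ?v = "pos (x [^] q \<otimes> inv (b [^] q) \<otimes> inv \<u>)"
    have "?v \<^bold>\<sqinter> band b m q r = \<one>" for m r
      using False disj by (intro separation_step) (auto simp: q_def)
    then have band: "(?v \<^bold>\<sqinter> ray b m q) \<^bold>\<sqinter> ray (inv b) (- r) q \<in> {\<one>}" for m r
      by (simp add: band_def meet_assoc)
    \<comment> \<open>Letting \<open>r\<close> vary removes the upper bound on \<open>b\<close>;
      exhaustion with \<open>inv b\<close> below then removes the lower bound
      \<open>m\<close>.\<close>
    have "?v \<^bold>\<sqinter> ray b m q \<in> {\<one>}" for m
      by (rule T.ray_exhaust[OF _ b band]) (auto intro: one_le_meet)
    then have upper: "?v \<^bold>\<sqinter> ray (inv (inv b)) (- r) q \<in> {\<one>}" for r by simp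
    have "?v \<in> {\<one>}" by (rule T.ray_exhaust[OF _ _ upper]) auto
    then have "x [^] q \<otimes> inv (b [^] q) \<preceq> \<u>"
      by (subst leq_iff_diff) (simp_all add: pos_eq_one_iff)
    then have "?z [^] n \<preceq> \<u>" by (simp add: q_def int_pow_int nat_pow_distrib nat_pow_inv)
    then have "pos (?z [^] n) \<preceq> \<u>" by (rule pos_least) simp
    then show ?thesis by (simp add: pos_pow)
  qed simp
  then have "pos ?z = \<one>" using archimedean[of "pos ?z" \<u>] one_le_pos[of ?z] by (simp add: leq_def)
  then show ?thesis by (subst leq_iff_diff) (simp_all add: pos_eq_one_iff)
qed

text \<open>The residual of the trivial kernel is the polar of the lower ray of \<open>b\<close>. It
  is a W-kernel containing \<open>ray b p q\<close>, hence also \<open>ray x p q\<close>, which is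
  the disjointness wanted.\<close>

lemma leq_of_rays_in_gen:
  assumes x [simp]: "x \<in> carrier G" and b [simp]: "b \<in> carrier G"
    and gen: "\<And>p q. 0 < q \<Longrightarrow> ray x p q \<in> gen {ray b p q}"
  shows "x \<preceq> b"
proof (rule leq_of_disjoint_rays)
  fix p q :: int assume q: "0 < q"
  let ?R = "residual {\<one>} (ray (inv b) (- p) q)"
  have "gen {ray b p q} \<subseteq> ?R"
    by (intro gen_least W_ideal_residual W_ideal_trivial)
      (auto simp: in_residual_iff W_ideal_trivial ray_disjoint)
  then have "ray x p q \<in> ?R" using gen[OF q] by blast
  then show "ray x p q \<^bold>\<sqinter> ray (inv b) (- p) q = \<one>" by (simp add: in_residual_iff W_ideal_trivial)
qed auto

lemma ray_mono: "g \<preceq> g' \<Longrightarrow> 0 \<le> q \<Longrightarrow> ray g p q \<preceq> ray g' p q"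
proof -
  assume le: "g \<preceq> g'" "0 \<le> q"
  have "g [^] q \<preceq> g' [^] q" using pow_mono[OF le(1), of "nat q"] le(2) by simp
  then show ?thesis using le(1) unfolding ray_def
    by (intro pos_mono mult_mono) (auto dest: leq_closed)
qed

lemma ray_eq_one_iff: "g \<in> carrier G \<Longrightarrow> ray g p q = \<one> \<longleftrightarrow> g [^] q \<preceq> \<u> [^] p"
  using leq_iff_diff[of "g [^] q" "\<u> [^] p"] by (simp add: ray_def pos_eq_one_iff)

section \<open>Suprema, infima and multiples\<close>

lemma is_lub_iff:
  assumes "A \<subseteq> carrier G"
  shows "is_lub (ord_of G) s A \<longleftrightarrow> s \<in> carrier G \<and> (\<forall>a\<in>A. a \<preceq> s) \<and>
    (\<forall>b\<in>carrier G. (\<forall>a\<in>A. a \<preceq> b) \<longrightarrow> s \<preceq> b)"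
  using assms unfolding least_def Upper_def by (simp add: leq_def) blast

lemma is_glb_iff:
  assumes "A \<subseteq> carrier G"
  shows "is_glb (ord_of G) s A \<longleftrightarrow> s \<in> carrier G \<and> (\<forall>a\<in>A. s \<preceq> a) \<and>
    (\<forall>b\<in>carrier G. (\<forall>a\<in>A. b \<preceq> a) \<longrightarrow> b \<preceq> s)"
  using assms unfolding greatest_def Lower_def by (simp add: leq_def) blast

lemma is_glb_iff_is_lub_inv:
  assumes A: "A \<subseteq> carrier G" and s: "s \<in> carrier G"
  shows "is_glb (ord_of G) s A \<longleftrightarrow> is_lub (ord_of G) (inv s) (m_inv G ` A)"
proof -
  have le: "inv a \<preceq> inv b \<longleftrightarrow> b \<preceq> a" if "a \<in> carrier G" "b \<in> carrier G" for a b
    using that inv_le_iff[of a "inv b"] by simp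
  note A' [simp] = subsetD[OF A]
  have "(\<forall>b\<in>carrier G. (\<forall>a\<in>A. inv a \<preceq> b) \<longrightarrow> inv s \<preceq> b) \<longleftrightarrow>
      (\<forall>b\<in>carrier G. (\<forall>a\<in>A. inv a \<preceq> inv b) \<longrightarrow> inv s \<preceq> inv b)"
    by (metis inv_closed inv_inv)
  then have "(\<forall>b\<in>carrier G. (\<forall>a\<in>A. inv a \<preceq> b) \<longrightarrow> inv s \<preceq> b) \<longleftrightarrow>
      (\<forall>b\<in>carrier G. (\<forall>a\<in>A. b \<preceq> a) \<longrightarrow> b \<preceq> s)"
    using s by (simp add: le)
  moreover have "m_inv G ` A \<subseteq> carrier G" by auto
  ultimately show ?thesis using A s by (simp add: is_glb_iff is_lub_iff le)
qed

text \<open>For \<open>x\<close> and \<open>y\<close> in \<open>D\<close>,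
  \<open>x [^] Suc n \<otimes> y\<close> is below a power of their join and hence below
  \<open>c\<close>. With \<open>y\<close> fixed, induction at \<open>c \<otimes> inv y\<close>
  replaces \<open>x\<close> by \<open>s\<close>; rearranging bounds every \<open>y\<close> by
  \<open>c \<otimes> inv (s [^] Suc n)\<close>, so \<open>s\<close> too.\<close>

lemma lub_pow_le:
  assumes dir: "\<And>x y. x \<in> D \<Longrightarrow> y \<in> D \<Longrightarrow> x \<^bold>\<squnion> y \<in> D" and D: "D \<subseteq> carrier G"
    and s: "s \<in> carrier G" "\<And>b. b \<in> carrier G \<Longrightarrow> (\<And>a. a \<in> D \<Longrightarrow> a \<preceq> b) \<Longrightarrow> s \<preceq> b"
    and c: "c \<in> carrier G" "\<And>a. a \<in> D \<Longrightarrow> a [^] Suc n \<preceq> c"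
  shows "s [^] Suc n \<preceq> c"
  using c
proof (induction n arbitrary: c)
  case 0
  then show ?case using s D by (auto simp: subset_iff)
next
  case (Suc n)
  note D' [simp] = subsetD[OF D]
  have cancel: "a \<preceq> c \<otimes> inv b \<longleftrightarrow> a \<otimes> b \<preceq> c" if [simp]: "a \<in> carrier G" "b \<in> carrier G" for a b
    using mult_right_mono[of a "c \<otimes> inv b" b] mult_right_mono[of "a \<otimes> b" c "inv b"] Suc.prems(1)
    by (auto simp: m_assoc)
  have 1: "s [^] Suc n \<preceq> c \<otimes> inv y" if y: "y \<in> D" for y
  proof (rule Suc.IH)
    fix x assume x: "x \<in> D"
    have "x [^] Suc n \<otimes> y \<preceq> (x \<^bold>\<squnion> y) [^] Suc n \<otimes> (x \<^bold>\<squnion> y)"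
      using x y by (intro mult_mono pow_mono) auto
    also have "\<dots> \<preceq> c" using Suc.prems(2)[OF dir[OF x y]] by simp
    finally show "x [^] Suc n \<preceq> c \<otimes> inv y" using x y by (subst cancel) auto
  qed (use Suc.prems y in auto)
  have "y \<preceq> c \<otimes> inv (s [^] Suc n)" if y: "y \<in> D" for y
  proof (subst cancel)
    show "y \<otimes> s [^] Suc n \<preceq> c" using 1[OF y] y s(1) by (subst (asm) cancel) (auto simp: m_comm)
  qed (use y s(1) in auto)
  then have "s \<preceq> c \<otimes> inv (s [^] Suc n)" using s Suc.prems by (intro s(2)) auto
  then have "s \<otimes> s [^] Suc n \<preceq> c" using s(1) by (subst (asm) cancel) auto
  then show ?case using s(1) by (simp add: m_comm)
qed

lemma is_lub_pow_le:
  assumes A: "A \<subseteq> carrier G" and s: "is_lub (ord_of G) s A" and n: "0 < n"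
    and c: "c \<in> carrier G" "\<And>a. a \<in> A \<Longrightarrow> a [^] (n::nat) \<preceq> c"
  shows "s [^] n \<preceq> c"
proof -
  obtain m where m: "n = Suc m" using n by (cases n) auto
  have "s [^] Suc m \<preceq> c"
  \<comment> \<open>\<open>A\<close> is enlarged to a set closed under joins, by
    \<open>join_pow\<close>, that is still bounded by \<open>s\<close> and still has its powers
    below \<open>c\<close>.\<close>
  proof (rule lub_pow_le[of "{a \<in> carrier G. a [^] n \<preceq> c \<and> a \<preceq> s}"])
    fix x y assume "x \<in> {a \<in> carrier G. a [^] n \<preceq> c \<and> a \<preceq> s}"
      "y \<in> {a \<in> carrier G. a [^] n \<preceq> c \<and> a \<preceq> s}"
    then show "x \<^bold>\<squnion> y \<in> {a \<in> carrier G. a [^] n \<preceq> c \<and> a \<preceq> s}" by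
      (auto simp: join_pow intro: join_least)
  next
    fix b assume "b \<in> carrier G" "\<And>a. a \<in> {a \<in> carrier G. a [^] n \<preceq> c \<and> a \<preceq> s} \<Longrightarrow> a \<preceq> b"
    then show "s \<preceq> b" using s A c is_lub_iff[OF A] by (simp add: subset_iff)
  qed (use c s is_lub_iff[OF A] m in auto)
  then show ?thesis by (simp add: m)
qed

section \<open>Pointwise suprema in terms of rays\<close>

lemma spectral_upper_subset_iff:
  assumes "f \<in> carrier G" "W_ideal G K"
  shows "spectral f {r<..} \<subseteq> K \<longleftrightarrow> (\<forall>p q. 0 < q \<longrightarrow> r < of_int p / of_int q \<longrightarrow> ray f p q \<in> K)"
proof -
  have "spectral f {r<..} = gen (\<Union>{ray_kernel G f p q | p q. 0 < q \<and> r < of_int p / of_int q})"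
    unfolding spectral_upper_ray[OF assms(1)]
    by (rule madden_frame_sup) (use assms(1) in \<open>auto simp: ray_kernel_eq W_ideal_gen\<close>)
  also have "\<dots> \<subseteq> K \<longleftrightarrow> (\<forall>p q. 0 < q \<longrightarrow> r < of_int p / of_int q \<longrightarrow> gen {ray f p q} \<subseteq> K)"
    using assms(2) by (subst gen_subset_iff) (auto simp: ray_kernel_eq)
  finally show ?thesis using assms(2) by (simp add: gen_subset_iff)
qed

lemma madden_rep_sup:
  assumes "F \<subseteq> carrier G" "open U"
  shows "\<Squnion>\<^bsub>madden_frame G\<^esub> ((\<lambda>f. madden_rep G f U) ` F) = gen (\<Union>f\<in>F. spectral f U)"
    and "W_ideal G (gen (\<Union>f\<in>F. spectral f U))"
proof -
  have eq: "(\<lambda>f. madden_rep G f U) ` F = (\<lambda>f. spectral f U) ` F"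
    using assms by (intro image_cong) (auto simp: madden_rep_eq)
  have "\<And>K. K \<in> (\<lambda>f. spectral f U) ` F \<Longrightarrow> W_ideal G K" using assms by auto
  then show "\<Squnion>\<^bsub>madden_frame G\<^esub> ((\<lambda>f. madden_rep G f U) ` F) = gen (\<Union>f\<in>F. spectral f U)"
    unfolding eq by (rule madden_frame_sup)
  show "W_ideal G (gen (\<Union>f\<in>F. spectral f U))"
    using assms W_ideal.subgroup[OF W_ideal_spectral] subgroup.subset by (intro W_ideal_gen) blast
qed

text \<open>A kernel is determined by the kernels that contain it, and a generated kernel lies in
  \<open>K\<close> iff its generators do; the frame equations thus become membership conditions on
  rays.\<close>

lemma pointwise_sup_iff:
  assumes F: "F \<subseteq> carrier G" and f\<^sub>0: "f\<^sub>0 \<in> carrier G"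
  shows "pointwise_sup G F f\<^sub>0 \<longleftrightarrow>
    (\<forall>K p q. W_ideal G K \<longrightarrow> 0 < q \<longrightarrow> (ray f\<^sub>0 p q \<in> K \<longleftrightarrow> (\<forall>f\<in>F. ray f p q \<in> K)))"
proof -
  have "pointwise_sup G F f\<^sub>0 \<longleftrightarrow> (\<forall>r. spectral f\<^sub>0 {r<..} = gen (\<Union>f\<in>F. spectral f {r<..}))"
    using F f\<^sub>0 by (simp add: pointwise_sup_def madden_rep_sup madden_rep_eq)
  also have "\<dots> \<longleftrightarrow>
    (\<forall>K p q. W_ideal G K \<longrightarrow> 0 < q \<longrightarrow> (ray f\<^sub>0 p q \<in> K \<longleftrightarrow> (\<forall>f\<in>F. ray f p q \<in> K)))"
  proof (rule iffI; intro allI impI)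
    fix K and p q :: int
    assume eq: "\<forall>r. spectral f\<^sub>0 {r<..} = gen (\<Union>f\<in>F. spectral f {r<..})" and K: "W_ideal G K"
      and q: "0 < q"
    have iff: "spectral f {of_int p / of_int q<..} \<subseteq> K \<longleftrightarrow> ray f p q \<in> K" if "f \<in> carrier G" for f
      using that q K by (simp add: spectral_ray gen_subset_iff)
    have "ray f\<^sub>0 p q \<in> K \<longleftrightarrow> gen (\<Union>f\<in>F. spectral f {of_int p / of_int q<..}) \<subseteq> K"
      using iff[OF f\<^sub>0] eq by simp
    also have "\<dots> \<longleftrightarrow> (\<forall>f\<in>F. spectral f {of_int p / of_int q<..} \<subseteq> K)" using K
      by (subst gen_subset_iff) auto
    finally show "ray f\<^sub>0 p q \<in> K \<longleftrightarrow> (\<forall>f\<in>F. ray f p q \<in> K)" using iff F by blast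
  next
    fix r :: real
    assume rays: "\<forall>K p q. W_ideal G K \<longrightarrow> 0 < q \<longrightarrow> (ray f\<^sub>0 p q \<in> K \<longleftrightarrow> (\<forall>f\<in>F. ray f p q \<in> K))"
    have "spectral f\<^sub>0 {r<..} \<subseteq> K \<longleftrightarrow> gen (\<Union>f\<in>F. spectral f {r<..}) \<subseteq> K" if K: "W_ideal G K" for K
    proof -
      have "gen (\<Union>f\<in>F. spectral f {r<..}) \<subseteq> K \<longleftrightarrow> (\<forall>f\<in>F. spectral f {r<..} \<subseteq> K)"
        using K by (subst gen_subset_iff) auto
      also have "\<dots> \<longleftrightarrow> (\<forall>f\<in>F. \<forall>p q. 0 < q \<longrightarrow> r < of_int p / of_int q \<longrightarrow> ray f p q \<in> K)"
        using F K by (intro ball_cong refl spectral_upper_subset_iff) auto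
      also have "\<dots> \<longleftrightarrow> spectral f\<^sub>0 {r<..} \<subseteq> K"
        using rays K f\<^sub>0 by (subst spectral_upper_subset_iff) auto
      finally show ?thesis ..
    qed
    \<comment> \<open>Taking \<open>K\<close> to be either of the two sides gives both
      inclusions.\<close>
    from this[OF W_ideal_spectral[OF f\<^sub>0]] this[OF madden_rep_sup(2)[OF F, of "{r<..}"]]
    show "spectral f\<^sub>0 {r<..} = gen (\<Union>f\<in>F. spectral f {r<..})" by auto
  qed
  finally show ?thesis .
qed

lemma pointwise_inf_iff_pointwise_sup_inv:
  assumes F: "F \<subseteq> carrier G" and f\<^sub>0: "f\<^sub>0 \<in> carrier G"
  shows "pointwise_inf G F f\<^sub>0 \<longleftrightarrow> pointwise_sup G (m_inv G ` F) (inv f\<^sub>0)"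
proof -
  have eq: "madden_rep G (inv f) {r<..} = madden_rep G f {..<-r}" if "f \<in> carrier G" for f r
    using that by (simp add: madden_rep_eq spectral_inv)
  have img: "(\<lambda>f. madden_rep G f {r<..}) ` m_inv G ` F = (\<lambda>f. madden_rep G f {..<-r}) ` F" for r
    unfolding image_image using F by (intro image_cong) (auto simp: eq)
  \<comment> \<open>As \<open>r\<close> runs through the reals, so does \<open>- r\<close>.\<close>
  show ?thesis unfolding pointwise_inf_def pointwise_sup_def img eq[OF f\<^sub>0] by (metis minus_minus)
qed

end

section \<open>Transfer along morphisms\<close>

context W_morphism
begin

text \<open>It is the kernel of \<open>\<theta>\<close> followed by the quotient map modulo
  \<open>N\<close>.\<close>

lemma W_ideal_preimage:
  assumes "W_ideal H N" shows "W_ideal G {x \<in> carrier G. \<theta> x \<in> N}"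
proof -
  interpret N: W_ideal H N by fact
  note quot_hom = W_morphism.hom[OF N.W_morphism_quot]
  have "W_morphism G N.quot (\<lambda>x. N #>\<^bsub>H\<^esub> \<theta> x)"
    by (intro W_morphism.intro W_morphism_axioms.intro dom.W_object_axioms N.W_object_quot)
      (use hom_compose[OF hom quot_hom] in \<open>simp_all add: comp_def join meet unit N.join_quot N.meet_quot\<close>)
  then have "W_ideal G (kernel G N.quot (\<lambda>x. N #>\<^bsub>H\<^esub> \<theta> x))" by (rule W_morphism.W_ideal_kernel)
  also have "kernel G N.quot (\<lambda>x. N #>\<^bsub>H\<^esub> \<theta> x) = {x \<in> carrier G. \<theta> x \<in> N}"
    by (simp add: kernel_def N.coset_eq_K cong: conj_cong)
  finally show ?thesis .
qed

lemma is_lub_of_pointwise_sup: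
  assumes F: "F \<subseteq> carrier G" and f\<^sub>0: "f\<^sub>0 \<in> carrier G" and sup: "pointwise_sup G F f\<^sub>0"
  shows "is_lub (ord_of H) (\<theta> f\<^sub>0) (\<theta> ` F)"
proof -
  have rays: "dom.ray f\<^sub>0 p q \<in> K \<longleftrightarrow> (\<forall>f\<in>F. dom.ray f p q \<in> K)" if "W_ideal G K" "0 < q" for K p q
    using sup that unfolding dom.pointwise_sup_iff[OF F f\<^sub>0] by blast
  \<comment> \<open>The kernel generated by \<open>ray f\<^sub>0 p q\<close> must contain
    \<open>ray f p q\<close>, which gives \<open>f \<le> f\<^sub>0\<close> already in
    \<open>G\<close>.\<close>
  have "cod.leq (\<theta> f) (\<theta> f\<^sub>0)" if f: "f \<in> F" for f
  proof (rule mono, rule dom.leq_of_rays_in_gen)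
    fix p q :: int assume "0 < q"
    then show "dom.ray f p q \<in> dom.gen {dom.ray f\<^sub>0 p q}"
      using rays[of "dom.gen {dom.ray f\<^sub>0 p q}"] f f\<^sub>0 dom.gen_superset[of "{dom.ray f\<^sub>0 p q}"]
      by (simp add: dom.W_ideal_gen)
  qed (use f F f\<^sub>0 in auto)
  moreover have "cod.leq (\<theta> f\<^sub>0) b" if b: "b \<in> carrier H" "\<forall>a\<in>\<theta> ` F. cod.leq a b" for b
  proof (rule cod.leq_of_rays_in_gen)
    fix p q :: int assume q: "0 < q"
    let ?N = "cod.gen {cod.ray b p q}"
    interpret N: W_ideal H ?N using b by (intro cod.W_ideal_gen) auto
    have "dom.ray f p q \<in> {x \<in> carrier G. \<theta> x \<in> ?N}" if f: "f \<in> F" for f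
    proof -
      have fc: "f \<in> carrier G" using f F by auto
      have "cod.leq (cod.ray (\<theta> f) p q) (cod.ray b p q)" using b f q by (intro cod.ray_mono) auto
      then have "cod.ray (\<theta> f) p q \<in> ?N"
        using cod.gen_superset[of "{cod.ray b p q}"] fc N.convex[of "cod.ray b p q"] by simp
      then show ?thesis using fc by (simp add: map_ray)
    qed
    then have "dom.ray f\<^sub>0 p q \<in> {x \<in> carrier G. \<theta> x \<in> ?N}"
      using rays[OF W_ideal_preimage[OF N.W_ideal_axioms] q] by blast
    then show "cod.ray (\<theta> f\<^sub>0) p q \<in> ?N" using f\<^sub>0 by (simp add: map_ray)
  qed (use b f\<^sub>0 in auto)
  ultimately show ?thesis using F f\<^sub>0 by (subst cod.is_lub_iff) auto
qed

end

context W_object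
begin

text \<open>Codomains on the type of \<open>G\<close> suffice, since every W-ideal is the kernel of
  a morphism into one of them.\<close>

lemma pointwise_sup_of_is_lub:
  assumes F: "F \<subseteq> carrier G" and f\<^sub>0: "f\<^sub>0 \<in> carrier G"
    and lub: "\<And>(H :: 'a wgroup) \<theta>. W_morphism G H \<theta> \<Longrightarrow> is_lub (ord_of H) (\<theta> f\<^sub>0) (\<theta> ` F)"
  shows "pointwise_sup G F f\<^sub>0"
  unfolding pointwise_sup_iff[OF F f\<^sub>0]
proof (intro allI impI)
  fix K and p q :: int assume K: "W_ideal G K" and q: "0 < q"
  obtain H :: "'a wgroup" and \<theta> where H: "W_morphism G H \<theta>" and K_eq: "K = kernel G H \<theta>"
    using K unfolding W_kernel_iff_W_ideal[symmetric] W_kernel_def by blast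
  interpret W_morphism G H \<theta> by (rule H)
  have sub: "\<theta> ` F \<subseteq> carrier H" using F by auto
  note lub' = lub[OF H]
  have iff: "ray f p q \<in> K \<longleftrightarrow> cod.leq (\<theta> f [^]\<^bsub>H\<^esub> nat q) (wunit H [^]\<^bsub>H\<^esub> p)" if "f \<in> carrier G" for f
    using that q by (simp add: K_eq kernel_def map_ray cod.ray_eq_one_iff)
  show "ray f\<^sub>0 p q \<in> K \<longleftrightarrow> (\<forall>f\<in>F. ray f p q \<in> K)"
  proof
    assume "ray f\<^sub>0 p q \<in> K"
    then have le: "cod.leq (\<theta> f\<^sub>0 [^]\<^bsub>H\<^esub> nat q) (wunit H [^]\<^bsub>H\<^esub> p)" by (simp only: iff[OF f\<^sub>0])
    show "\<forall>f\<in>F. ray f p q \<in> K"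
    proof
      fix f assume f: "f \<in> F"
      then have "cod.leq (\<theta> f) (\<theta> f\<^sub>0)" using lub' cod.is_lub_iff[OF sub] by blast
      then have "cod.leq (\<theta> f [^]\<^bsub>H\<^esub> nat q) (wunit H [^]\<^bsub>H\<^esub> p)"
        using cod.pow_mono le cod.leq_trans by blast
      then show "ray f p q \<in> K" using f F iff by blast
    qed
  next
    assume "\<forall>f\<in>F. ray f p q \<in> K"
    then have "cod.leq (a [^]\<^bsub>H\<^esub> nat q) (wunit H [^]\<^bsub>H\<^esub> p)" if "a \<in> \<theta> ` F" for a
      using that F iff by blast
    then have "cod.leq (\<theta> f\<^sub>0 [^]\<^bsub>H\<^esub> nat q) (wunit H [^]\<^bsub>H\<^esub> p)"
      using q by (intro cod.is_lub_pow_le[OF sub lub']) auto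
    then show "ray f\<^sub>0 p q \<in> K" by (simp only: iff[OF f\<^sub>0])
  qed
qed

end

lemma (in W_morphism) is_glb_map_iff:
  assumes F: "F \<subseteq> carrier G" and f\<^sub>0: "f\<^sub>0 \<in> carrier G"
  shows "is_glb (ord_of H) (\<theta> f\<^sub>0) (\<theta> ` F) \<longleftrightarrow>
    is_lub (ord_of H) (\<theta> (inv\<^bsub>G\<^esub> f\<^sub>0)) (\<theta> ` m_inv G ` F)"
proof -
  have "\<theta> ` m_inv G ` F = m_inv H ` \<theta> ` F" unfolding image_image using F by (intro image_cong) auto
  moreover have "\<theta> ` F \<subseteq> carrier H" using F by auto
  ultimately show ?thesis using f\<^sub>0 by (simp add: cod.is_glb_iff_is_lub_inv)
qed

theorem proposition4p2p4:
  fixes G :: "'a wgroup" and F :: "'a set" and f\<^sub>0 :: 'a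
  assumes "W_object G" and "F \<subseteq> carrier G" and "f\<^sub>0 \<in> carrier G"
  shows "(pointwise_sup G F f\<^sub>0 \<longleftrightarrow>
      (\<forall>(H :: 'a wgroup) \<theta>. W_morphism G H \<theta> \<longrightarrow> is_lub (ord_of H) (\<theta> f\<^sub>0) (\<theta> ` F)) \<and>
      (\<forall>(H :: 'h wgroup) \<theta>. W_morphism G H \<theta> \<longrightarrow> is_lub (ord_of H) (\<theta> f\<^sub>0) (\<theta> ` F))) \<and>
    (pointwise_inf G F f\<^sub>0 \<longleftrightarrow>
      (\<forall>(H :: 'a wgroup) \<theta>. W_morphism G H \<theta> \<longrightarrow> is_glb (ord_of H) (\<theta> f\<^sub>0) (\<theta> ` F)) \<and>
      (\<forall>(H :: 'h wgroup) \<theta>. W_morphism G H \<theta> \<longrightarrow> is_glb (ord_of H) (\<theta> f\<^sub>0) (\<theta> ` F)))"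
proof -
  interpret W_object G by fact
  \<comment> \<open>Kept general in \<open>A\<close> and \<open>a\<close>, so that the infimum part
    can use it at the inverses of \<open>F\<close> and \<open>f\<^sub>0\<close>. The forward
    direction holds for either codomain type; the backward one takes codomains on the type of
    \<open>G\<close>.\<close>
  have sup: "pointwise_sup G A a \<longleftrightarrow>
      (\<forall>(H :: 'a wgroup) \<theta>. W_morphism G H \<theta> \<longrightarrow> is_lub (ord_of H) (\<theta> a) (\<theta> ` A)) \<and>
      (\<forall>(H :: 'h wgroup) \<theta>. W_morphism G H \<theta> \<longrightarrow> is_lub (ord_of H) (\<theta> a) (\<theta> ` A))"
    if "A \<subseteq> carrier G" "a \<in> carrier G" for A a
    by (intro iffI conjI allI impI pointwise_sup_of_is_lub that;
      (erule (1) W_morphism.is_lub_of_pointwise_sup[OF _ that] | blast))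
  have inv: "m_inv G ` F \<subseteq> carrier G" "inv\<^bsub>G\<^esub> f\<^sub>0 \<in> carrier G" using assms by auto
  show ?thesis
    unfolding pointwise_inf_iff_pointwise_sup_inv[OF assms(2,3)] sup[OF assms(2,3)] sup[OF inv]
    by (simp only: W_morphism.is_glb_map_iff[OF _ assms(2,3)] cong: imp_cong)
qed

end
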